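(* Let $x,y,\nu,s\in\mathbb{C}$ satisfy $\Re(x+s)>0$, $\Re(y+s)>0$, $\Re(s-\nu)>0$ and $\Re(s+\nu)>-1$. Then $$\int_0^\infty p^{s-1}\,B_{\nu}(x,y;p)\,dp=\frac{2^{s-1}}{\sqrt{\pi}}\,\Gamma\left(\frac{s-\nu}{2}\right)\Gamma\left(\frac{s+\nu+1}{2}\right)B(x+s,y+s),$$ provided that each side exists.
   Context: $K_\mu(z)$ denotes the modified Bessel function of the second kind of order $\mu$. For $x,y,\nu\in\mathbb{C}$ and $p>0$ the extended Beta function is $$B_{\nu}(x,y;p):= \sqrt{\frac{2p}{\pi}}\int_{0}^{1} t^{x-\frac{3}{2}}(1-t)^{y-\frac{3}{2}}\, K_{\nu+\frac{1}{2}}\left(\frac{p}{t(1-t)}\right)dt .$$ $B(x,y)$ (two arguments) is the classical Euler Beta function, $B(x,y)=\int_0^1t^{x-1}(1-t)^{y-1}dt$ for $\Re(x),\Re(y)>0$. The left-hand side of the claim is the Mellin transform of $B_\nu(x,y;p)$ in the variable $p$. *)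

theory Defs
  imports "HOL-Analysis.Analysis"
begin

text \<open>Powers are principal branches; \<^const>\<open>rGamma\<close> is the entire function
  \<open>1 / \<Gamma>\<close>, so the series is correct for every complex order.\<close>

definition bessel_I :: "complex \<Rightarrow> complex \<Rightarrow> complex" where
  "bessel_I \<mu> z =
     (z / 2) powr \<mu> * (\<Sum>k. (z / 2) ^ (2 * k) * rGamma (\<mu> + of_nat k + 1) / fact k)"

definition bessel_K_quot :: "complex \<Rightarrow> complex \<Rightarrow> complex" where
  "bessel_K_quot \<mu> z =
     of_real pi / 2 * (bessel_I (- \<mu>) z - bessel_I \<mu> z) / sin (\<mu> * of_real pi)"

text \<open>At integer orders the quotient is \<open>0 / 0\<close>, and the function is by convention
  the limit in the order.\<close>

definition bessel_K :: "complex \<Rightarrow> complex \<Rightarrow> complex" where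
  "bessel_K \<mu> z =
     (if \<mu> \<in> \<int> then Lim (at \<mu>) (\<lambda>m. bessel_K_quot m z) else bessel_K_quot \<mu> z)"

definition ext_Beta :: "complex \<Rightarrow> complex \<Rightarrow> complex \<Rightarrow> real \<Rightarrow> complex" where
  "ext_Beta \<nu> x y p =
     of_real (sqrt (2 * p / pi)) *
     (LBINT t:{0<..<1}. of_real t powr (x - 3 / 2) * of_real (1 - t) powr (y - 3 / 2) *
        bessel_K (\<nu> + 1 / 2) (of_real (p / (t * (1 - t)))))"

end

theory Submission
  imports Defs "HOL-Real_Asymp.Real_Asymp"
begin

text \<open>
  Put \<open>w = (z / 2)\<^sup>2\<close>. Then \<open>I\<^sub>\<mu>(z) = (z / 2)\<^sup>\<mu> A\<^sub>\<mu>(w)\<close> with the entire function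
  \<open>A\<^sub>\<mu>(w) = \<Sum>\<^sub>k w\<^sup>k / (k! \<Gamma>(\<mu> + k + 1))\<close>, and the claim \<open>K\<^sub>\<mu>(z) = (z / 2)\<^bsup>-\<mu>\<^esup> G\<^sub>\<mu>(w) / 2\<close> for
  \<open>G\<^sub>\<mu>(w) = \<integral>\<^sub>0\<^sup>\<infinity> t\<^bsup>\<mu>-1\<^esup> e\<^bsup>-t-w/t\<^esup> dt\<close> is obtained without the Bessel equation. The contiguous
  relations of \<open>A\<close> and \<open>G\<close> make \<open>w G\<^sub>\<mu> A\<^bsub>\<mu>+1\<^esub> + G\<^bsub>\<mu>+1\<^esub> A\<^sub>\<mu>\<close> invariant under \<open>\<mu> \<mapsto> \<mu> + 1\<close>, and
  its limit along \<open>\<mu> + n\<close> is \<open>1\<close>. Taking this identity at \<open>-\<mu>\<close> and at \<open>\<mu> - 1\<close>, with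
  \<open>G\<^bsub>-\<mu>\<^esub> = w\<^bsup>-\<mu>\<^esup> G\<^sub>\<mu>\<close>, and eliminating \<open>G\<^bsub>\<mu>-1\<^esub>\<close> expresses \<open>G\<^sub>\<mu>\<close> through \<open>A\<^bsub>\<plusminus>\<mu>\<^esub>\<close> and the
  Wronskian of \<open>I\<^bsub>\<plusminus>\<mu>\<^esub>\<close>. Integer orders follow since \<open>G\<^sub>\<mu>\<close> is continuous in \<open>\<mu>\<close>.

  The integral representation gives the absolutely convergent Mellin transform
  \<open>\<integral>\<^sub>0\<^sup>\<infinity> z\<^bsup>c-1\<^esup> K\<^sub>\<mu>(z) dz = 2\<^bsup>c-2\<^esup> \<Gamma>((c - \<mu>) / 2) \<Gamma>((c + \<mu>) / 2)\<close>. In the theorem, Fubini and the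
  scaling \<open>p = t (1 - t) z\<close> separate the double integral into this transform at \<open>c = s + 1/2\<close>,
  \<open>\<mu> = \<nu> + 1/2\<close> and a Beta integral.
\<close>

section \<open>The Bessel--Clifford function\<close>

text \<open>The regularised hypergeometric function 0F1(; a + 1; w) / \<Gamma>(a + 1). Working with
  \<open>rGamma\<close> gives it a value at negative integer orders as well.\<close>

definition bessel_clifford :: "complex \<Rightarrow> complex \<Rightarrow> complex" where
  "bessel_clifford a w = (\<Sum>k. rGamma (a + of_nat k + 1) / fact k * w ^ k)"

lemma summable_bessel_clifford:
  "summable (\<lambda>k. rGamma (a + of_nat k + 1) / fact k * w ^ k :: complex)"
proof -
  \<comment> \<open>From index \<open>N\<close> on, \<open>norm (a + of_nat k + 1)\<close> is at
    least 1 and \<open>norm w / real (Suc k)\<close> is at most 1/2; together these give the ratio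
    1/2.\<close>
  obtain N :: nat where N: "real N \<ge> 2 * norm w + norm a + 1"
    using real_arch_simple by blast
  show ?thesis
  proof (rule summable_ratio_test[of "1/2" N])
    fix k assume k: "k \<ge> N"
    define b where "b = a + of_nat k + 1"
    have "1 \<le> real k + 1 - norm a" using k N norm_ge_zero[of w] by linarith
    also have "\<dots> \<le> norm b"
      using norm_triangle_ineq2[of "of_nat (Suc k)" "-a"] unfolding b_def
      by (simp add: algebra_simps del: norm_minus_cancel) (metis norm_minus_cancel norm_of_nat of_nat_Suc add.commute)
    finally have b1: "norm b \<ge> 1" .
    have "norm (rGamma (b + 1)) \<le> norm b * norm (rGamma (b + 1))"
      using b1 by (simp add: mult_le_cancel_right1)
    also have "\<dots> = norm (rGamma b)" by (metis norm_mult rGamma_plus1)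
    finally have g: "norm (rGamma (b + 1)) \<le> norm (rGamma b)" .
    have w: "norm w / real (Suc k) \<le> 1 / 2" using k N norm_ge_zero[of a] by (simp add: field_simps del: norm_ge_zero)
    have "norm (rGamma (a + of_nat (Suc k) + 1) / fact (Suc k) * w ^ Suc k) =
          (norm w / real (Suc k)) * (norm (rGamma (b + 1)) * (norm w ^ k / fact k))"
      by (simp add: norm_mult norm_divide norm_power b_def field_simps del: of_nat_Suc) 
         (simp add: algebra_simps)
    also have "\<dots> \<le> 1/2 * (norm (rGamma b) * (norm w ^ k / fact k))"
      using w g by (intro mult_mono) auto
    also have "\<dots> = 1/2 * norm (rGamma (a + of_nat k + 1) / fact k * w ^ k)"
      by (simp add: norm_mult norm_divide norm_power b_def)
    finally show "norm (rGamma (a + of_nat (Suc k) + 1) / fact (Suc k) * w ^ Suc k)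
      \<le> 1 / 2 * norm (rGamma (a + of_nat k + 1) / fact k * w ^ k)" .
  qed auto
qed

lemma diffs_bessel_clifford:
  "diffs (\<lambda>k. rGamma (a + of_nat k + 1) / fact k :: complex) =
   (\<lambda>k. rGamma (a + 1 + of_nat k + 1) / fact k)"
proof
  fix k
  have "of_nat (Suc k) / fact (Suc k) = (1 / fact k :: complex)"
    by (simp add: fact_Suc divide_simps del: of_nat_Suc)
  thus "diffs (\<lambda>k. rGamma (a + of_nat k + 1) / fact k) k = rGamma (a + 1 + of_nat k + 1) / fact k"
    unfolding diffs_def by (simp add: add_ac divide_inverse mult_ac)
qed

lemma has_field_derivative_bessel_clifford:
  "(bessel_clifford a has_field_derivative bessel_clifford (a + 1) w) (at w)"
  using termdiffs_strong_converges_everywhere[OF summable_bessel_clifford[of a], of w]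
  unfolding diffs_bessel_clifford bessel_clifford_def[abs_def] .

lemma bessel_clifford_0: "bessel_clifford a 0 = rGamma (a + 1)"
  unfolding bessel_clifford_def
  using powser_zero[of "\<lambda>k. rGamma (a + of_nat k + 1) / fact k"] by simp

text \<open>The functional equation of \<open>rGamma\<close> puts a factor a + 1 + k into the k-th
  coefficient. Its part a + 1 gives the first term on the right; its part k cancels against k! and
  shifts the series by one power of w.\<close>

lemma bessel_clifford_recurrence:
  "bessel_clifford a w = (a + 1) * bessel_clifford (a + 1) w + w * bessel_clifford (a + 2) w"
proof -
  define c where "c = (\<lambda>b k. rGamma (b + of_nat k + 1) / fact k * w ^ k)"
  have sm: "summable (c b)" for b unfolding c_def by (rule summable_bessel_clifford)
  have eq: "c a (Suc k) = (a + 1) * c (a + 1) (Suc k) + w * c (a + 2) k" for k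
  proof -
    have "rGamma (a + of_nat (Suc k) + 1) = (a + 1 + of_nat (Suc k)) * rGamma (a + 1 + of_nat (Suc k) + 1)"
      by (subst rGamma_plus1[symmetric]) (simp add: algebra_simps)
    hence "c a (Suc k) = (a + 1) * c (a + 1) (Suc k) +
        of_nat (Suc k) * rGamma (a + 1 + of_nat (Suc k) + 1) / fact (Suc k) * w ^ Suc k"
      unfolding c_def by (simp add: algebra_simps add_divide_distrib)
    also have "of_nat (Suc k) * rGamma (a + 1 + of_nat (Suc k) + 1) / fact (Suc k) * w ^ Suc k = w * c (a + 2) k"
      unfolding c_def by (simp add: field_simps del: of_nat_Suc) (simp add: algebra_simps)
    finally show ?thesis .
  qed
  have "bessel_clifford a w = c a 0 + (\<Sum>k. c a (Suc k))"
    using suminf_split_head[OF sm[of a]] by (simp add: bessel_clifford_def c_def)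
  also have "(\<Sum>k. c a (Suc k)) = (a + 1) * (\<Sum>k. c (a + 1) (Suc k)) + w * (\<Sum>k. c (a + 2) k)"
    unfolding eq using sm[THEN summable_ignore_initial_segment, of _ 1] sm
    by (subst suminf_add[symmetric]) (simp_all add: suminf_mult summable_mult)
  also have "(\<Sum>k. c (a + 1) (Suc k)) = bessel_clifford (a + 1) w - c (a + 1) 0"
    using suminf_split_head[OF sm[of "a + 1"]] by (simp add: bessel_clifford_def c_def)
  also have "(\<Sum>k. c (a + 2) k) = bessel_clifford (a + 2) w"
    by (simp add: bessel_clifford_def c_def)
  also have "c a 0 = (a + 1) * c (a + 1) 0"
    unfolding c_def using rGamma_plus1[of "a + 1"] by simp
  finally show ?thesis by (simp add: algebra_simps)
qed

text \<open>The Wronskian of \<open>I\<^sub>\<mu>\<close> and \<open>I\<^bsub>-\<mu>\<^esub>\<close>, rewritten with the contiguous relations; it is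
  constant in \<open>w\<close>, so it can be evaluated at \<open>w = 0\<close>.\<close>
lemma bessel_clifford_wronskian:
  "bessel_clifford (\<mu> - 1) w * bessel_clifford (- \<mu>) w
     - w * bessel_clifford (1 - \<mu>) w * bessel_clifford \<mu> w = sin (of_real pi * \<mu>) / of_real pi"
proof -
  define V where "V = (\<lambda>w. bessel_clifford (\<mu> - 1) w * bessel_clifford (- \<mu>) w
     - w * bessel_clifford (1 - \<mu>) w * bessel_clifford \<mu> w)"
  have "(V has_field_derivative 0) (at w)" for w
  proof -
    have d: "(bessel_clifford b has_field_derivative bessel_clifford c w) (at w)" if "c = b + 1" for b c
      using has_field_derivative_bessel_clifford[of b w] that by simp
    have "(V has_field_derivative
       (bessel_clifford \<mu> w * bessel_clifford (-\<mu>) w + bessel_clifford (1-\<mu>) w * bessel_clifford (\<mu> - 1) w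
       - ((1 * bessel_clifford (1 - \<mu>) w + bessel_clifford (2 - \<mu>) w * w) * bessel_clifford \<mu> w
          + bessel_clifford (\<mu> + 1) w * (w * bessel_clifford (1 - \<mu>) w)))) (at w)"
      unfolding V_def by (intro DERIV_diff DERIV_mult DERIV_ident d) auto
    also have "(bessel_clifford \<mu> w * bessel_clifford (-\<mu>) w + bessel_clifford (1-\<mu>) w * bessel_clifford (\<mu> - 1) w
       - ((1 * bessel_clifford (1 - \<mu>) w + bessel_clifford (2 - \<mu>) w * w) * bessel_clifford \<mu> w
          + bessel_clifford (\<mu> + 1) w * (w * bessel_clifford (1 - \<mu>) w))) = 0"
    proof -
      have "bessel_clifford (- \<mu>) w = (1 - \<mu>) * bessel_clifford (1 - \<mu>) w + w * bessel_clifford (2 - \<mu>) w"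
        using bessel_clifford_recurrence[of "-\<mu>" w] by (simp add: add.commute)
      moreover have "bessel_clifford (\<mu> - 1) w = \<mu> * bessel_clifford \<mu> w + w * bessel_clifford (\<mu> + 1) w"
        using bessel_clifford_recurrence[of "\<mu> - 1" w] by (simp add: add.commute)
      ultimately show ?thesis by (simp only:) (simp add: algebra_simps)
    qed
    finally show ?thesis .
  qed
  hence "\<exists>c. \<forall>x\<in>UNIV. V x = c"
    by (intro has_field_derivative_zero_constant) auto
  hence "V w = V 0" by auto
  \<comment> \<open>At 0 the second product vanishes and the first is
    \<open>rGamma \<mu> * rGamma (1 - \<mu>)\<close>, which the reflection formula
    evaluates.\<close>
  also have "V 0 = sin (of_real pi * \<mu>) / of_real pi"
    using rGamma_reflection_complex[of \<mu>] by (simp add: V_def bessel_clifford_0)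
  finally show ?thesis by (simp add: V_def)
qed

lemma bessel_I_conv_bessel_clifford:
  "bessel_I \<mu> z = (z / 2) powr \<mu> * bessel_clifford \<mu> ((z / 2)\<^sup>2)"
  by (simp add: bessel_I_def bessel_clifford_def power_mult[symmetric] mult_ac)

text \<open>Normalised by \<open>\<Gamma>(a + 1)\<close>, every coefficient beyond the first is \<open>O(1 / Re a)\<close>.\<close>
lemma norm_Gamma_mult_bessel_clifford_le:
  assumes "Re a \<ge> 0"
  shows "norm (Gamma (a + 1) * bessel_clifford a w - 1) \<le> exp (norm w) / (Re a + 1)"
proof -
  define f where "f = (\<lambda>k. Gamma (a + 1) * (rGamma (a + of_nat k + 1) / fact k * w ^ k))"
  have na: "a + 1 \<notin> \<int>\<^sub>\<le>\<^sub>0" using assms by (auto elim!: nonpos_Ints_cases simp: complex_eq_iff)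
  have sm: "summable f" unfolding f_def by (intro summable_mult summable_bessel_clifford)
  have f0: "f 0 = 1" using na unfolding f_def by (simp add: rGamma_inverse_Gamma Gamma_eq_zero_iff)
  have bound: "norm (f (Suc k)) \<le> (norm w ^ Suc k / fact (Suc k)) / (Re a + 1)" for k
  proof -
    have "rGamma (a + 1) = pochhammer (a + 1) (Suc k) * rGamma (a + 1 + of_nat (Suc k))"
      by (rule pochhammer_rGamma)
    \<comment> \<open>The first factor a + 1 already has modulus at least Re a + 1, and every
      further factor has real part at least 1.\<close>
    moreover have P: "norm (pochhammer (a + 1) (Suc k)) \<ge> Re a + 1"
    proof (induction k)
      case 0
      show ?case using complex_Re_le_cmod[of "a + 1"] by simp
    next
      case (Suc k)
      have "1 \<le> Re (a + 1 + of_nat (Suc k))" using assms by simp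
      also have "\<dots> \<le> norm (a + 1 + of_nat (Suc k))" by (rule complex_Re_le_cmod)
      finally have "norm (pochhammer (a + 1) (Suc k)) * 1 \<le>
         norm (pochhammer (a + 1) (Suc k)) * norm (a + 1 + of_nat (Suc k))"
        by (intro mult_left_mono) auto
      thus ?case using Suc by (subst pochhammer_Suc) (simp add: norm_mult)
    qed
    hence "pochhammer (a + 1) (Suc k) \<noteq> 0" using assms by auto
    ultimately have "Gamma (a + 1) * rGamma (a + of_nat (Suc k) + 1) = 1 / pochhammer (a + 1) (Suc k)"
      using na by (simp add: rGamma_inverse_Gamma field_simps Gamma_eq_zero_iff add_ac del: pochhammer_Suc)
    hence "f (Suc k) = w ^ Suc k / fact (Suc k) / pochhammer (a + 1) (Suc k)"
      unfolding f_def by (simp add: field_simps)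
    hence "norm (f (Suc k)) = (norm w ^ Suc k / fact (Suc k)) / norm (pochhammer (a + 1) (Suc k))"
      by (simp only: norm_divide norm_power norm_fact)
    also have "\<dots> \<le> (norm w ^ Suc k / fact (Suc k)) / (Re a + 1)"
      using P assms by (intro divide_left_mono) (auto intro!: mult_pos_pos)
    finally show ?thesis .
  qed
  have se: "(\<lambda>k. norm w ^ k / fact k) sums exp (norm w)"
    using exp_converges[of "norm w"] by (simp add: field_simps)
  hence se': "(\<lambda>k. norm w ^ Suc k / fact (Suc k) / (Re a + 1)) sums ((exp (norm w) - 1) / (Re a + 1))"
    by (intro sums_divide) (subst sums_Suc_iff, simp)
  have "Gamma (a + 1) * bessel_clifford a w = suminf f"
    unfolding f_def bessel_clifford_def by (intro suminf_mult[symmetric] summable_bessel_clifford)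
  also have "\<dots> - 1 = (\<Sum>k. f (Suc k))" using suminf_split_head[OF sm] f0 by simp
  also have "norm \<dots> \<le> (\<Sum>k. norm w ^ Suc k / fact (Suc k) / (Re a + 1))"
    by (rule norm_suminf_le[OF bound sums_summable[OF se']])
  also have "\<dots> = (exp (norm w) - 1) / (Re a + 1)" using se' by (rule sums_unique[symmetric])
  also have "\<dots> \<le> exp (norm w) / (Re a + 1)" using assms by (intro divide_right_mono) auto
  finally show ?thesis .
qed

section \<open>Powers and substitution under the Lebesgue integral\<close>

lemma of_real_powr_complex:
  assumes "t > 0" shows "complex_of_real t powr z = exp (z * of_real (ln t))"
  using assms by (simp add: powr_def Ln_of_real)

lemma norm_of_real_powr:
  assumes "t > 0" shows "norm (complex_of_real t powr z) = t powr Re z"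
  using assms by (simp add: of_real_powr_complex powr_def)

text \<open>The principal branch jumps across the negative real axis, so measurability is read off
  its explicit form for positive, zero and negative base.\<close>

lemma borel_measurable_of_real_powr [measurable (raw)]:
  fixes f :: "'a \<Rightarrow> real"
  assumes [measurable]: "f \<in> borel_measurable M"
  shows "(\<lambda>x. complex_of_real (f x) powr z) \<in> borel_measurable M"
proof -
  have "(\<lambda>x. complex_of_real (f x) powr z) =
    (\<lambda>x. if f x > 0 then exp (z * of_real (ln (f x))) else if f x = 0 then 0
       else exp (z * (of_real (ln (- f x)) + of_real pi * \<i>)))"
  proof
    fix x
    show "complex_of_real (f x) powr z = (if f x > 0 then exp (z * of_real (ln (f x))) else if f x = 0 then 0
       else exp (z * (of_real (ln (- f x)) + of_real pi * \<i>)))"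
      using Ln_of_real'[of "f x"]
      by (auto simp: of_real_powr_complex powr_def not_less)
  qed
  also have "\<dots> \<in> borel_measurable M" by measurable
  finally show ?thesis .
qed

text \<open>Passing to the completion does not affect integrability of a Borel function. This
  carries change of variables and Euler's integral from \<open>lebesgue\<close> over to
  \<open>lborel\<close>, where Fubini is applied.\<close>

lemma set_integrable_lebesgue_iff_lborel:
  fixes f :: "real \<Rightarrow> 'a :: {banach, second_countable_topology}"
  assumes "f \<in> borel_measurable borel" "A \<in> sets borel"
  shows "set_integrable lebesgue A f \<longleftrightarrow> set_integrable lborel A f"
proof -
  have "(\<lambda>x. indicator A x *\<^sub>R f x) \<in> borel_measurable lborel" using assms by measurable
  thus ?thesis unfolding set_integrable_def by (rule integrable_completion)
qed

lemma substitution_lborel: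
  fixes f :: "real \<Rightarrow> complex" and g h :: "real \<Rightarrow> real"
  assumes [measurable]: "f \<in> borel_measurable borel" "g \<in> borel_measurable borel"
     "h \<in> borel_measurable borel" "S \<in> sets borel" "g ` S \<in> sets borel"
  assumes deriv: "\<And>x. x \<in> S \<Longrightarrow> (g has_field_derivative h x) (at x)" and inj: "inj_on g S"
  shows "set_integrable lborel (g ` S) f \<longleftrightarrow> set_integrable lborel S (\<lambda>x. \<bar>h x\<bar> *\<^sub>R f (g x))" (is ?th1)
    and "(LBINT x:g ` S. f x) = (LBINT x:S. \<bar>h x\<bar> *\<^sub>R f (g x))" (is ?th2)
proof -
  have S: "S \<in> sets lebesgue" using assms by simp
  note cv = has_absolute_integral_change_of_variables_real[of S g h f, OF S has_field_derivative_at_within[OF deriv] inj]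
  have l1: "set_integrable lebesgue (g ` S) f \<longleftrightarrow> set_integrable lborel (g ` S) f"
    by (intro set_integrable_lebesgue_iff_lborel) measurable
  have l2: "set_integrable lebesgue S (\<lambda>x. \<bar>h x\<bar> *\<^sub>R f (g x)) \<longleftrightarrow> set_integrable lborel S (\<lambda>x. \<bar>h x\<bar> *\<^sub>R f (g x))"
    by (intro set_integrable_lebesgue_iff_lborel) measurable
  show 1: ?th1
    using cv l1 l2 by blast
  show ?th2
  proof (cases "set_integrable lborel (g ` S) f")
    case True
    thus ?thesis using 1 cv l1 l2 by (simp add: set_borel_integral_eq_integral(2)) (metis (no_types))
  next
    \<comment> \<open>Here neither side is integrable, and both integrals take the default value
      0.\<close>
    case False
    thus ?thesis using 1 unfolding set_integrable_def set_lebesgue_integral_def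
      by (simp add: not_integrable_integral_eq)
  qed
qed

section \<open>The integral representation of \<open>K\<^sub>\<mu>\<close>\<close>

lemma power_le_fact_mult_exp:
  fixes x :: real assumes "x \<ge> 0" shows "x ^ n \<le> fact n * exp x"
proof -
  have "x ^ n / fact n \<le> (\<Sum>k. x ^ k / fact k)"
    using sum_le_suminf[of "\<lambda>k. x ^ k / fact k" "{n}"] assms summable_exp[of x]
    by (simp add: field_simps)
  also have "\<dots> = exp x" by (simp add: exp_def field_simps)
  finally show ?thesis by (simp add: field_simps)
qed

lemma Gamma_integral_lborel:
  assumes "Re a > 0"
  shows "set_integrable lborel {0<..} (\<lambda>t. of_real t powr (a - 1) * of_real (exp (- t)))" (is ?th1)
    and "(LBINT t:{0<..}. of_real t powr (a - 1) * of_real (exp (- t))) = Gamma a" (is ?th2)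
proof -
  let ?f = "\<lambda>t::real. complex_of_real t powr (a - 1) * of_real (exp (- t))"
  have eq: "?f = (\<lambda>t. of_real t powr (a - 1) / of_real (exp t))"
    by (auto simp: exp_minus divide_inverse)
  have "set_integrable lebesgue {0<..} ?f"
    unfolding eq using absolutely_integrable_Gamma_integral'[OF assms] .
  thus 1: ?th1 by (subst (asm) set_integrable_lebesgue_iff_lborel) measurable
  show ?th2 using Gamma_integral_complex'[OF assms]
    unfolding set_borel_integral_eq_integral(2)[OF 1] unfolding eq by (rule integral_unique)
qed

lemma Gamma_integral_real_lborel:
  assumes "a > (0::real)"
  shows "set_integrable lborel {0<..} (\<lambda>t. t powr (a - 1) * exp (- t))" (is ?th1)
    and "(LBINT t:{0<..}. t powr (a - 1) * exp (- t)) = Gamma a" (is ?th2)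
proof -
  have eq: "(\<lambda>t. indicator {0<..} t *\<^sub>R (of_real t powr (of_real a - 1) * of_real (exp (- t)))) =
     (\<lambda>t. complex_of_real (indicator {0<..} t *\<^sub>R (t powr (a - 1) * exp (- t))))"
    by (auto simp: indicator_def powr_of_real[symmetric])
  note G = Gamma_integral_lborel[of "of_real a"]
  show ?th1 using G(1) assms unfolding set_integrable_def eq complex_of_real_integrable_eq by simp
  show ?th2 using G(2) assms unfolding set_lebesgue_integral_def eq integral_complex_of_real
    by (simp add: Gamma_complex_of_real)
qed

text \<open>The generalised Gamma function of Chaudhry and Zubair, a deformation of Euler's
  integral. For w > 0 the factor exp (- w / t) damps the integrand at 0, so every complex order is
  admissible.\<close>

definition ext_Gamma :: "complex \<Rightarrow> real \<Rightarrow> complex" where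
  "ext_Gamma a w = (LBINT t:{0<..}. of_real t powr (a - 1) * of_real (exp (- t - w / t)))"

lemma set_integrable_ext_Gamma:
  fixes a :: complex
  assumes "w > 0"
  shows "set_integrable lborel {0<..} (\<lambda>t. of_real t powr (a - 1) * of_real (exp (- t - w / t)))"
proof -
  \<comment> \<open>One term of the exponential series bounds exp (- w / t) by a multiple of t ^ n.
    With this \<open>n\<close> the order Re a + n is positive, so \<open>g\<close> is a multiple of
    a convergent Gamma integrand.\<close>
  obtain n :: nat where n: "real n > - Re a" using reals_Archimedean2 by blast
  define g where "g = (\<lambda>t. fact n / w ^ n * (t powr (Re a + n - 1) * exp (- t)))"
  have "set_integrable lborel {0<..} g"
    unfolding g_def using n by (intro set_integrable_mult_right Gamma_integral_real_lborel) auto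
  thus ?thesis
  proof (rule set_integrable_bound)
    show "set_borel_measurable lborel {0<..} (\<lambda>t. complex_of_real t powr (a - 1) * of_real (exp (- t - w / t)))"
      unfolding set_borel_measurable_def by measurable
    have "norm (complex_of_real t powr (a - 1) * of_real (exp (- t - w / t))) \<le> norm (g t)" if "t > 0" for t
    proof -
      have "(w / t) ^ n \<le> fact n * exp (w / t)" using that assms by (intro power_le_fact_mult_exp) auto
      hence "exp (- (w / t)) \<le> fact n / w ^ n * t ^ n"
        using that assms by (simp add: exp_minus field_simps)
      hence "t powr (Re a - 1) * (exp (- t) * exp (- (w / t))) \<le>
         t powr (Re a - 1) * (exp (- t) * (fact n / w ^ n * t ^ n))"
        by (intro mult_left_mono) auto
      also have "\<dots> = g t"
        using that by (simp add: g_def powr_add powr_diff powr_realpow field_simps)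
      finally show ?thesis using that
        by (simp add: norm_mult norm_of_real_powr exp_add[symmetric])
    qed
    thus "AE t in lborel. t \<in> {0<..} \<longrightarrow> norm (complex_of_real t powr (a - 1) * of_real (exp (- t - w / t))) \<le> norm (g t)"
      by auto
  qed
qed

text \<open>The substitution t = w / u exchanges the two terms t and w / t of the exponent.\<close>

lemma ext_Gamma_minus:
  assumes w: "w > 0"
  shows "ext_Gamma (- a) w = of_real w powr (- a) * ext_Gamma a w"
proof -
  let ?f = "\<lambda>t. complex_of_real t powr (- a - 1) * of_real (exp (- t - w / t))"
  define g where "g = (\<lambda>t. w / t)"
  have im: "g ` {0<..} = {0<..}"
  proof -
    have "t \<in> g ` {0<..}" if "t > 0" for t
      using that w by (intro image_eqI[of _ _ "w / t"]) (auto simp: g_def)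
    thus ?thesis using w by (auto simp: g_def)
  qed
  have "ext_Gamma (- a) w = (LBINT t:g ` {0<..}. ?f t)"
    unfolding ext_Gamma_def im ..
  also have "\<dots> = (LBINT t:{0<..}. \<bar>- w / t\<^sup>2\<bar> *\<^sub>R ?f (g t))"
  proof (rule substitution_lborel)
    show "g ` {0<..} \<in> sets borel" unfolding im by simp
    show "inj_on g {0<..}" using w by (auto simp: inj_on_def g_def field_simps)
    show "(g has_field_derivative - w / x\<^sup>2) (at x)" if "x \<in> {0<..}" for x
      using that unfolding g_def by (auto intro!: derivative_eq_intros simp: power2_eq_square)
  qed (auto simp: g_def)
  also have "\<dots> = (LBINT t:{0<..}. of_real w powr (- a) * (of_real t powr (a - 1) * of_real (exp (- t - w / t))))"
  proof (rule set_lebesgue_integral_cong)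
    show "\<forall>t. t \<in> {0<..} \<longrightarrow> \<bar>- w / t\<^sup>2\<bar> *\<^sub>R ?f (g t) =
       of_real w powr (- a) * (of_real t powr (a - 1) * of_real (exp (- t - w / t)))"
    proof (intro allI impI)
      fix t :: real assume "t \<in> {0<..}"
      hence t: "t > 0" by simp
      have "complex_of_real (w / t\<^sup>2) = exp (of_real (ln w) - 2 * of_real (ln t))"
        using t w by (simp add: exp_diff exp_double exp_of_real)
      moreover have "complex_of_real (g t) powr (- a - 1) = exp ((- a - 1) * (of_real (ln w) - of_real (ln t)))"
        using t w of_real_powr_complex[of "g t" "- a - 1"] by (simp add: g_def ln_div del: of_real_divide)
      moreover have "exp (of_real (ln w) - 2 * of_real (ln t)) * exp ((- a - 1) * (of_real (ln w) - of_real (ln t)))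
         = exp (- a * of_real (ln w)) * exp ((a - 1) * complex_of_real (ln t))"
        by (simp add: exp_add[symmetric] algebra_simps)
      ultimately have "complex_of_real (w / t\<^sup>2) * complex_of_real (g t) powr (- a - 1) =
         of_real w powr (- a) * of_real t powr (a - 1)"
        using t w by (simp add: of_real_powr_complex)
      moreover have "- g t - w / g t = - t - w / t" using t w by (simp add: g_def)
      moreover have "\<bar>- w / t\<^sup>2\<bar> = w / t\<^sup>2" using t w by simp
      ultimately show "\<bar>- w / t\<^sup>2\<bar> *\<^sub>R ?f (g t) =
         of_real w powr (- a) * (of_real t powr (a - 1) * of_real (exp (- t - w / t)))"
        by (simp only: scaleR_conv_of_real mult.assoc[symmetric])
    qed
  qed auto
  also have "\<dots> = of_real w powr (- a) * ext_Gamma a w"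
    unfolding ext_Gamma_def by simp
  finally show ?thesis .
qed

text \<open>Integrate the derivative of t powr a * exp (- t - w / t) over the half-line; the
  boundary values vanish and the product rule yields the three terms.\<close>

lemma ext_Gamma_recurrence:
  assumes w: "w > 0"
  shows "ext_Gamma (a + 1) w = a * ext_Gamma a w + of_real w * ext_Gamma (a - 1) w"
proof -
  let ?g = "\<lambda>a t. complex_of_real t powr (a - 1) * of_real (exp (- t - w / t))"
  define F where "F = ?g (a + 1)"
  define f where "f = (\<lambda>t. a * ?g a t - ?g (a + 1) t + of_real w * ?g (a - 1) t)"
  note int = set_integrable_ext_Gamma[OF w]
  have "(LBINT t=0..\<infinity>. f t) = 0 - 0"
  proof (rule interval_integral_FTC_integrable)
    fix t assume "0 < ereal t" 
    hence t: "t > 0" by simp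
    show "(F has_vector_derivative f t) (at t)"
    proof (rule has_vector_derivative_transform_within_open)
      define u where "u = (\<lambda>t. a * complex_of_real (ln t) + of_real (- t - w / t))"
      have "(u has_vector_derivative (a * of_real (1 / t) + of_real (- 1 + w / t\<^sup>2))) (at t)"
        unfolding u_def using t
        by (intro has_vector_derivative_add has_vector_derivative_mult_right has_vector_derivative_of_real)
           (auto intro!: derivative_eq_intros simp: power2_eq_square has_real_derivative_iff_has_vector_derivative[symmetric])
      from field_vector_diff_chain_at[OF this DERIV_exp]
      have "((\<lambda>t. exp (u t)) has_vector_derivative
              (a * of_real (1 / t) + of_real (- 1 + w / t\<^sup>2)) * exp (u t)) (at t)" by (simp add: o_def)
      also have "exp (u t) = F t"
        using t by (simp add: u_def F_def of_real_powr_complex exp_add exp_of_real[symmetric])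
      also have "(a * of_real (1 / t) + of_real (- 1 + w / t\<^sup>2)) * F t = f t"
        using t by (simp add: F_def f_def powr_diff field_simps power2_eq_square)
      finally show "((\<lambda>t. exp (u t)) has_vector_derivative f t) (at t)" .
      show "exp (u x) = F x" if "x \<in> {0<..}" for x
        using that by (simp add: u_def F_def of_real_powr_complex exp_add exp_of_real[symmetric])
    qed (use t in auto)
    show "isCont f t"
      using t unfolding f_def by (auto intro!: continuous_intros)
  next
    show "set_integrable lborel (einterval 0 \<infinity>) f"
    proof -
      have "einterval 0 \<infinity> = {0<..}" by (auto simp: einterval_def)
      moreover have "set_integrable lborel {0<..} f"
        unfolding f_def by (intro set_integral_add(1) set_integral_diff(1) set_integrable_mult_right int)
      ultimately show ?thesis by simp
    qed
    have nF: "norm (F t) = t powr Re a * exp (- t - w / t)" if "t > 0" for t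
      using that by (simp add: F_def norm_mult norm_of_real_powr)
    \<comment> \<open>At 0 the factor exp (- w / t) beats every power of t since w is positive; at
      infinity exp (- t) does.\<close>
    have "((\<lambda>t. t powr Re a * exp (- t - w / t)) \<longlongrightarrow> 0) (at_right 0)"
      using w by real_asymp
    hence "((\<lambda>t. norm (F t)) \<longlongrightarrow> 0) (at_right 0)"
      by (rule Lim_transform_eventually) (use nF in \<open>auto simp: eventually_at_filter\<close>)
    thus "((F \<circ> real_of_ereal) \<longlongrightarrow> 0) (at_right 0)"
      unfolding zero_ereal_def ereal_tendsto_simps by (rule tendsto_norm_zero_cancel)
    have "((\<lambda>t. t powr Re a * exp (- t - w / t)) \<longlongrightarrow> 0) at_top"
      using w by real_asymp
    hence "((\<lambda>t. norm (F t)) \<longlongrightarrow> 0) at_top"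
      by (rule Lim_transform_eventually)
         (use nF in \<open>auto intro: eventually_mono[OF eventually_gt_at_top[of 0]]\<close>)
    thus "((F \<circ> real_of_ereal) \<longlongrightarrow> 0) (at_left \<infinity>)"
      unfolding ereal_tendsto_simps by (rule tendsto_norm_zero_cancel)
  qed auto
  hence "0 = (LBINT t:{0<..}. f t)" by (simp add: interval_lebesgue_integral_0_infty)
  also have "\<dots> = a * ext_Gamma a w - ext_Gamma (a + 1) w + of_real w * ext_Gamma (a - 1) w"
  proof -
    have i1: "set_integrable lborel {0<..} (\<lambda>t. a * ?g a t)" and
         i3: "set_integrable lborel {0<..} (\<lambda>t. of_real w * ?g (a - 1) t)"
      by (intro set_integrable_mult_right int)+
    note i2 = int[of "a + 1"]
    show ?thesis
      unfolding f_def ext_Gamma_def set_integral_mult_right[symmetric]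
        set_integral_add(2)[OF set_integral_diff(1)[OF i1 i2] i3] set_integral_diff(2)[OF i1 i2] ..
  qed
  finally show ?thesis by (simp add: algebra_simps)
qed

section \<open>Asymptotics for large order\<close>

text \<open>The integrands differ by the factor 1 - exp (- w / t), which lies between 0 and w / t.
  This lowers the exponent by one, and Re a > 1 keeps the resulting Gamma integral
  convergent.\<close>

lemma norm_ext_Gamma_minus_Gamma_le:
  assumes w: "w > 0" and a: "Re a > 1"
  shows "norm (ext_Gamma a w - Gamma a) \<le> w * Gamma (Re a - 1)"
proof -
  let ?f = "\<lambda>t. complex_of_real t powr (a - 1) * of_real (exp (- t - w / t))
                - of_real t powr (a - 1) * of_real (exp (- t))"
  let ?g = "\<lambda>t. w * (t powr (Re a - 1 - 1) * exp (- t))"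
  have i1: "set_integrable lborel {0<..} ?f" and
       i2: "(LBINT t:{0<..}. ?f t) = ext_Gamma a w - Gamma a"
    using set_integrable_ext_Gamma[OF w, of a] Gamma_integral_lborel[of a] a
    by (auto simp: set_integral_diff ext_Gamma_def)
  have "norm (LBINT t:{0<..}. ?f t) \<le> (LBINT t:{0<..}. norm (?f t))"
    by (rule set_integral_norm_bound[OF i1])
  also have "\<dots> \<le> (LBINT t:{0<..}. ?g t)"
  proof (rule set_integral_mono)
    show "set_integrable lborel {0<..} (\<lambda>t. norm (?f t))" by (rule set_integrable_norm[OF i1])
    show "set_integrable lborel {0<..} ?g"
      using a by (intro set_integrable_mult_right Gamma_integral_real_lborel) auto
    fix t :: real assume "t \<in> {0<..}"
    hence t: "t > 0" by simp
    have "?f t = of_real t powr (a - 1) * of_real (exp (- t)) * of_real (exp (- (w / t)) - 1)"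
      by (simp add: exp_diff exp_minus field_simps)
    hence "norm (?f t) = t powr (Re a - 1) * exp (- t) * \<bar>exp (- (w / t)) - 1\<bar>"
      using t by (simp only: norm_mult norm_of_real norm_of_real_powr) simp
    also have "\<bar>exp (- (w / t)) - 1\<bar> \<le> w / t"
      using t w exp_ge_add_one_self[of "- (w / t)"] by simp
    hence "t powr (Re a - 1) * exp (- t) * \<bar>exp (- (w / t)) - 1\<bar> \<le> t powr (Re a - 1) * exp (- t) * (w / t)"
      by (intro mult_left_mono) auto
    also have "\<dots> = ?g t" using t by (simp add: powr_diff field_simps power2_eq_square)
    finally show "norm (?f t) \<le> ?g t" .
  qed
  also have "\<dots> = w * Gamma (Re a - 1)"
    using a Gamma_integral_real_lborel(2)[of "Re a - 1"] by simp
  finally show ?thesis by (simp add: i2)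
qed

text \<open>\<open>\<bar>\<Gamma>(a + n)\<bar> / \<Gamma>(Re a + n)\<close> increases with \<open>n\<close>.\<close>
lemma norm_Gamma_add_of_nat_ge:
  assumes "Re a > 0"
  obtains c where "c > 0" "\<And>n. norm (Gamma (a + of_nat n)) \<ge> c * Gamma (Re a + real n)"
proof
  have np: "a + of_nat n \<notin> \<int>\<^sub>\<le>\<^sub>0" for n
    using assms by (auto elim!: nonpos_Ints_cases simp: complex_eq_iff)
  define c where "c = norm (Gamma a) / Gamma (Re a)"
  show "c > 0" using np[of 0] assms by (auto simp: c_def Gamma_eq_zero_iff intro!: divide_pos_pos Gamma_real_pos)
  show "norm (Gamma (a + of_nat n)) \<ge> c * Gamma (Re a + real n)" for n
  proof (induction n)
    case 0
    thus ?case using Gamma_real_pos[of "Re a"] assms by (simp add: c_def)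
  next
    case (Suc n)
    have "c * Gamma (Re a + real (Suc n)) = (Re a + n) * (c * Gamma (Re a + n))"
    proof -
      have "Re a + real n \<notin> \<int>\<^sub>\<le>\<^sub>0" using assms by (auto elim!: nonpos_Ints_cases)
      from Gamma_plus1[OF this] show ?thesis by (simp add: add_ac)
    qed
    also have "\<dots> \<le> norm (a + of_nat n) * norm (Gamma (a + of_nat n))"
      using assms Suc complex_Re_le_cmod[of "a + of_nat n"] \<open>c > 0\<close> Gamma_real_pos[of "Re a + n"]
      by (intro mult_mono) auto
    also have "\<dots> = norm (Gamma (a + of_nat (Suc n)))"
      using Gamma_plus1[OF np[of n]] by (simp add: norm_mult[symmetric] add_ac)
    finally show ?case .
  qed
qed

text \<open>The error bound involves \<Gamma> at the real part, whereas the division is by \<Gamma>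
  at the complex point. The lower bound on \<open>norm (Gamma (a + of_nat n))\<close> makes them
  comparable and leaves O(1 / n).\<close>

lemma ext_Gamma_div_Gamma_tendsto:
  assumes w: "w > 0" and a: "Re a > 1"
  shows "(\<lambda>n. ext_Gamma (a + of_nat n) w / Gamma (a + of_nat n)) \<longlonglongrightarrow> 1"
proof -
  obtain c where c: "c > 0" "\<And>n. norm (Gamma (a + of_nat n)) \<ge> c * Gamma (Re a + real n)"
    using norm_Gamma_add_of_nat_ge[of a] a by auto
  have "norm (ext_Gamma (a + of_nat n) w / Gamma (a + of_nat n) - 1) \<le> w / c / (Re a + real n - 1)" for n
  proof -
    have pos: "Gamma (Re a + real n - 1) > 0" "Gamma (Re a + real n) > 0"
      using a by (auto intro!: Gamma_real_pos)
    have nz: "norm (Gamma (a + of_nat n)) > 0" using c(2)[of n] c(1) pos mult_pos_pos by (smt (verit))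
    have "ext_Gamma (a + of_nat n) w / Gamma (a + of_nat n) - 1 =
        (ext_Gamma (a + of_nat n) w - Gamma (a + of_nat n)) / Gamma (a + of_nat n)"
      using nz by (simp add: field_simps)
    also have "norm \<dots> \<le> (w * Gamma (Re a + real n - 1)) / (c * Gamma (Re a + real n))"
      unfolding norm_divide
      using norm_ext_Gamma_minus_Gamma_le[OF w, of "a + of_nat n"] a c pos w
      by (intro frac_le) auto
    also have "Gamma (Re a + real n) = (Re a + real n - 1) * Gamma (Re a + real n - 1)"
    proof -
      have "Re a + real n - 1 \<notin> \<int>\<^sub>\<le>\<^sub>0" using a by (auto elim!: nonpos_Ints_cases)
      from Gamma_plus1[OF this] show ?thesis by simp
    qed
    also have "w * Gamma (Re a + real n - 1) / (c * ((Re a + real n - 1) * Gamma (Re a + real n - 1))) =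
        w / c / (Re a + real n - 1)" using pos by simp
    finally show ?thesis .
  qed
  hence bound: "\<forall>\<^sub>F n in sequentially. norm (ext_Gamma (a + of_nat n) w / Gamma (a + of_nat n) - 1)
      \<le> w / c / (Re a + real n - 1)" by (rule always_eventually[OF allI])
  have "(\<lambda>n. w / c / (Re a + real n - 1)) \<longlonglongrightarrow> 0" by real_asymp
  from Lim_null_comparison[OF bound this]
  have "(\<lambda>n. ext_Gamma (a + of_nat n) w / Gamma (a + of_nat n) - 1) \<longlonglongrightarrow> 0" .
  thus ?thesis by (simp add: LIM_zero_iff)
qed

lemma Gamma_mult_bessel_clifford_tendsto:
  assumes a: "Re a \<ge> 0"
  shows "(\<lambda>n. Gamma (a + of_nat n + 1) * bessel_clifford (a + of_nat n) w) \<longlonglongrightarrow> 1"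
proof -
  have "(\<lambda>n. exp (norm w) / (Re a + real n + 1)) \<longlonglongrightarrow> 0" by real_asymp
  hence "(\<lambda>n. Gamma (a + of_nat n + 1) * bessel_clifford (a + of_nat n) w - 1) \<longlonglongrightarrow> 0"
    by (rule Lim_null_comparison[rotated])
       (use a norm_Gamma_mult_bessel_clifford_le[of "a + of_nat n" w for n] in \<open>auto\<close>)
  thus ?thesis by (simp add: LIM_zero_iff)
qed

text \<open>The Wronskian of \<open>K\<^sub>\<mu>\<close> and \<open>I\<^sub>\<mu>\<close>. It is invariant under \<open>\<mu> \<mapsto> \<mu> + 1\<close> by the contiguous
  relations, hence equal to its limit as \<open>\<mu> + n \<rightarrow> \<infinity>\<close>.\<close>
lemma ext_Gamma_bessel_clifford_wronskian:
  assumes w: "w > 0"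
  shows "of_real w * ext_Gamma \<mu> w * bessel_clifford (\<mu> + 1) (of_real w)
         + ext_Gamma (\<mu> + 1) w * bessel_clifford \<mu> (of_real w) = 1"
proof -
  define U where "U = (\<lambda>\<mu>. of_real w * ext_Gamma \<mu> w * bessel_clifford (\<mu> + 1) (of_real w)
         + ext_Gamma (\<mu> + 1) w * bessel_clifford \<mu> (of_real w))"
  have step: "U (\<mu> + 1) = U \<mu>" for \<mu>
  proof -
    have "ext_Gamma (\<mu> + 2) w = (\<mu> + 1) * ext_Gamma (\<mu> + 1) w + of_real w * ext_Gamma \<mu> w"
      using ext_Gamma_recurrence[OF w, of "\<mu> + 1"] by (simp add: add_ac)
    moreover have "bessel_clifford \<mu> (of_real w) = (\<mu> + 1) * bessel_clifford (\<mu> + 1) (of_real w)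
       + of_real w * bessel_clifford (\<mu> + 2) (of_real w)"
      by (rule bessel_clifford_recurrence)
    moreover have "\<mu> + 1 + 1 = \<mu> + 2" by simp
    ultimately show ?thesis unfolding U_def by (simp only:) (simp add: algebra_simps)
  qed
  have shift: "U (\<mu> + of_nat n) = U \<mu>" for \<mu> n
    by (induction n) (use step[of "\<mu> + of_nat n" for n] in \<open>auto simp: add_ac\<close>)
  \<comment> \<open>By \<open>shift\<close> the order may be moved to real part above 1, where both
    limits are available.\<close>
  obtain N :: nat where N: "real N > 1 - Re \<mu>" using reals_Archimedean2 by blast
  define a where "a = \<mu> + of_nat N"
  have a: "Re a > 1" using N by (simp add: a_def)
  define g where "g = (\<lambda>a n. ext_Gamma (a + of_nat n) w / Gamma (a + of_nat n))"
  define b where "b = (\<lambda>a n. Gamma (a + of_nat n + 1) * bessel_clifford (a + of_nat n) (of_real w))"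
  \<comment> \<open>In terms of the normalised factors the first summand carries \<Gamma>(m) /
    \<Gamma>(m + 2) = 1 / (m (m + 1)) with m = a + n, which tends to 0; in the second the \<Gamma>
    factors cancel.\<close>
  have U_eq: "U (a + of_nat n) = of_real w * g a n * b (a + 1) n / ((a + of_nat n) * (a + of_nat n + 1))
       + g (a + 1) n * b a n" for n
  proof -
    define m where "m = a + of_nat n"
    have m: "m \<notin> \<int>\<^sub>\<le>\<^sub>0" "m + 1 \<notin> \<int>\<^sub>\<le>\<^sub>0"
      using a by (auto simp: m_def complex_eq_iff elim!: nonpos_Ints_cases)
    have nz: "m \<noteq> 0" "m + 1 \<noteq> 0" "Gamma m \<noteq> 0"
      using m by (auto simp: Gamma_eq_zero_iff)
    have e: "a + of_nat n = m" "a + 1 + of_nat n = m + 1" by (simp_all add: m_def)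
    have G: "Gamma (m + 1 + 1) = (m + 1) * (m * Gamma m)" "Gamma (m + 1) = m * Gamma m"
      using m by (simp_all only: Gamma_plus1 simp_thms)
    show ?thesis using nz unfolding U_def g_def b_def e G by simp
  qed
  have "(\<lambda>n. of_real w * g a n * b (a + 1) n / ((a + of_nat n) * (a + of_nat n + 1))
       + g (a + 1) n * b a n) \<longlonglongrightarrow> of_real w * 1 * 1 * 0 + 1 * 1"
  proof -
    have 0: "(\<lambda>n. 1 / ((a + of_nat n) * (a + of_nat n + 1))) \<longlonglongrightarrow> 0"
    proof (rule Lim_null_comparison)
      show "(\<lambda>n. 1 / ((Re a + real n) * (Re a + real n + 1))) \<longlonglongrightarrow> 0" by real_asymp
      have "norm (1 / ((a + of_nat n) * (a + of_nat n + 1))) \<le> 1 / ((Re a + real n) * (Re a + real n + 1))" for n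
        using a complex_Re_le_cmod[of "a + of_nat n"] complex_Re_le_cmod[of "a + of_nat n + 1"]
        unfolding norm_divide norm_mult norm_one
        by (intro divide_left_mono mult_mono mult_pos_pos) auto
      thus "\<forall>\<^sub>F n in sequentially. norm (1 / ((a + of_nat n) * (a + of_nat n + 1))) \<le> 1 / ((Re a + real n) * (Re a + real n + 1))"
        by simp
    qed
    have "g a \<longlonglongrightarrow> 1" "g (a + 1) \<longlonglongrightarrow> 1" "b a \<longlonglongrightarrow> 1" "b (a + 1) \<longlonglongrightarrow> 1"
      using a w unfolding g_def b_def
      by (intro ext_Gamma_div_Gamma_tendsto Gamma_mult_bessel_clifford_tendsto; simp)+
    hence "(\<lambda>n. of_real w * g a n * b (a + 1) n * (1 / ((a + of_nat n) * (a + of_nat n + 1)))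
       + g (a + 1) n * b a n) \<longlonglongrightarrow> of_real w * 1 * 1 * 0 + 1 * 1"
      by (intro tendsto_intros 0)
    thus ?thesis by simp
  qed
  hence "(\<lambda>n. U (a + of_nat n)) \<longlonglongrightarrow> 1" unfolding U_eq by simp
  moreover have "U (a + of_nat n) = U \<mu>" for n unfolding a_def by (simp add: shift)
  ultimately have "U \<mu> = 1" by (simp add: LIMSEQ_const_iff)
  thus ?thesis by (simp add: U_def)
qed

text \<open>After reflection, the Wronskian identities at \<mu> - 1 and - \<mu> form a linear system
  for \<open>ext_Gamma\<close> at \<mu> and \<mu> - 1. Its determinant is, up to a power of w, the
  Wronskian of the two I-type solutions, hence the sine.\<close>

lemma ext_Gamma_conv_bessel_clifford:
  assumes w: "w > 0"
  shows "ext_Gamma \<mu> w * (sin (of_real pi * \<mu>) / of_real pi) =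
         bessel_clifford (- \<mu>) (of_real w) - of_real w powr \<mu> * bessel_clifford \<mu> (of_real w)"
proof -
  let ?A = "\<lambda>a. bessel_clifford a (of_real w)"
  let ?w = "complex_of_real w"
  define G where "G = (\<lambda>a. ext_Gamma a w)"
  have 1: "?w * G (\<mu> - 1) * ?A \<mu> + G \<mu> * ?A (\<mu> - 1) = 1"
    using ext_Gamma_bessel_clifford_wronskian[OF w, of "\<mu> - 1"] by (simp add: G_def)
  have "?w * G (- \<mu>) * ?A (1 - \<mu>) + G (1 - \<mu>) * ?A (- \<mu>) = 1"
    using ext_Gamma_bessel_clifford_wronskian[OF w, of "- \<mu>"] by (simp add: G_def)
  also have "G (- \<mu>) = ?w powr (- \<mu>) * G \<mu>" unfolding G_def by (rule ext_Gamma_minus[OF w])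
  also have "G (1 - \<mu>) = ?w powr (- \<mu>) * ?w * G (\<mu> - 1)"
    using ext_Gamma_minus[OF w, of "\<mu> - 1"] w by (simp add: G_def powr_diff powr_minus field_simps)
  finally have "?w powr \<mu> * ?A \<mu> * (?w powr (- \<mu>) * (?w * G \<mu> * ?A (1 - \<mu>) + ?w * G (\<mu> - 1) * ?A (- \<mu>)))
       = ?w powr \<mu> * ?A \<mu>" by (simp add: algebra_simps)
  moreover have "?w powr \<mu> * ?w powr (- \<mu>) = 1" using w by (simp add: powr_minus)
  moreover have "?w powr \<mu> * ?A \<mu> * (?w powr (- \<mu>) * X) = (?w powr \<mu> * ?w powr (- \<mu>)) * (?A \<mu> * X)" for X
    by (simp add: mult_ac)
  ultimately have 2: "?A \<mu> * (?w * G \<mu> * ?A (1 - \<mu>) + ?w * G (\<mu> - 1) * ?A (- \<mu>)) = ?w powr \<mu> * ?A \<mu>"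
    by (simp only: mult_1)
  \<comment> \<open>Elimination as in Cramer's rule: the two terms containing
    \<open>G (\<mu> - 1)\<close> cancel.\<close>
  have "G \<mu> * (?A (\<mu> - 1) * ?A (- \<mu>) - ?w * ?A (1 - \<mu>) * ?A \<mu>)
      = ?A (- \<mu>) * (?w * G (\<mu> - 1) * ?A \<mu> + G \<mu> * ?A (\<mu> - 1)) 
       - ?A \<mu> * (?w * G \<mu> * ?A (1 - \<mu>) + ?w * G (\<mu> - 1) * ?A (- \<mu>))"
    by (simp add: algebra_simps)
  also have "\<dots> = ?A (- \<mu>) - ?w powr \<mu> * ?A \<mu>" unfolding 1 2 by simp
  finally show ?thesis unfolding bessel_clifford_wronskian by (simp add: G_def)
qed

text \<open>Dominated convergence along sequences of orders, from the index on at which they stay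
  within distance 1 of a.\<close>

lemma continuous_ext_Gamma:
  assumes w: "w > 0"
  shows "isCont (\<lambda>a. ext_Gamma a w) a"
  unfolding continuous_at_sequentially
proof (intro allI impI)
  fix X assume X: "X \<longlonglongrightarrow> a"
  let ?f = "\<lambda>a t. indicator {0<..} t *\<^sub>R (complex_of_real t powr (a - 1) * of_real (exp (- t - w / t)))"
  \<comment> \<open>For orders within distance 1 of a, the integrand at order a + 1 dominates when t
    \<ge> 1 and the one at order a - 1 when t < 1; the sum serves for both.\<close>
  define b where "b = (\<lambda>t. norm (?f (a + 1) t) + norm (?f (a - 1) t))"
  obtain N where N: "\<And>n. n \<ge> N \<Longrightarrow> dist (X n) a < 1"
    using X unfolding lim_sequentially by (meson zero_less_one)
  have "(\<lambda>n. \<integral>t. ?f (X (n + N)) t \<partial>lborel) \<longlonglongrightarrow> (\<integral>t. ?f a t \<partial>lborel)"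
  proof (rule integral_dominated_convergence[where w = b])
    show "integrable lborel b" unfolding b_def
      using set_integrable_ext_Gamma[OF w] unfolding set_integrable_def
      by (intro Bochner_Integration.integrable_add integrable_norm)
    have "(\<lambda>n. ?f (X (n + N)) t) \<longlonglongrightarrow> ?f a t" for t
    proof (cases "t > 0")
      case True
      have "(\<lambda>n. exp ((X (n + N) - 1) * of_real (ln t)) * of_real (exp (- t - w / t)))
         \<longlonglongrightarrow> exp ((a - 1) * of_real (ln t)) * complex_of_real (exp (- t - w / t))"
        by (intro tendsto_intros LIMSEQ_ignore_initial_segment X)
      thus ?thesis using True by (simp add: of_real_powr_complex)
    qed auto
    thus "AE t in lborel. (\<lambda>n. ?f (X (n + N)) t) \<longlonglongrightarrow> ?f a t" by simp
    have "norm (?f (X (n + N)) t) \<le> b t" for n t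
    proof (cases "t > 0")
      case True
      have "\<bar>Re (X (n + N)) - Re a\<bar> \<le> norm (X (n + N) - a)" using abs_Re_le_cmod[of "X (n + N) - a"] by simp
      hence *: "\<bar>Re (X (n + N)) - Re a\<bar> \<le> 1" using N[of "n + N"] by (simp add: dist_norm)
      have "t powr (Re (X (n + N)) - 1) \<le> t powr (Re a) + t powr (Re a - 2)"
      proof (cases "t \<ge> 1")
        case True
        hence "t powr (Re (X (n + N)) - 1) \<le> t powr (Re a)" using * by (intro powr_mono) auto
        thus ?thesis by (simp add: add_increasing2)
      next
        case False
        hence "t powr (Re (X (n + N)) - 1) \<le> t powr (Re a - 2)" using * \<open>t > 0\<close> by (intro powr_mono') auto
        thus ?thesis by (simp add: add_increasing)
      qed
      hence "t powr (Re (X (n + N)) - 1) * exp (- t - w / t) \<le> (t powr (Re a) + t powr (Re a - 2)) * exp (- t - w / t)"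
        by (intro mult_right_mono) auto
      thus ?thesis using True by (simp add: b_def norm_mult norm_of_real_powr algebra_simps)
    qed (auto simp: b_def)
    thus "\<And>n. AE t in lborel. norm (?f (X (n + N)) t) \<le> b t" by simp
  qed (measurable)
  hence "(\<lambda>n. ext_Gamma (X (n + N)) w) \<longlonglongrightarrow> ext_Gamma a w"
    by (simp add: ext_Gamma_def set_lebesgue_integral_def)
  thus "((\<lambda>a. ext_Gamma a w) \<circ> X) \<longlonglongrightarrow> ext_Gamma a w"
    unfolding o_def by (rule LIMSEQ_offset)
qed

section \<open>Identification with the Bessel function, for non-integer and then integer
  order\<close>

text \<open>For w = (z / 2)^2 the power w powr \<mu> is the square of (z / 2) powr \<mu>. Dividing
  the preceding identity by the sine, nonzero at such orders, gives the defining quotient.\<close>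

lemma bessel_K_quot_conv_ext_Gamma:
  assumes z: "z > 0" and \<mu>: "\<mu> \<notin> \<int>"
  shows "bessel_K_quot \<mu> (of_real z) = of_real (z / 2) powr (- \<mu>) * ext_Gamma \<mu> ((z / 2)\<^sup>2) / 2"
proof -
  define q where "q = z / 2"
  have q: "q > 0" using z by (simp add: q_def)
  have s: "sin (of_real pi * \<mu>) \<noteq> 0"
    using \<mu> by (auto simp: sin_eq_0 mult.commute)
  have qq: "complex_of_real (q\<^sup>2) powr \<mu> = of_real q powr \<mu> * of_real q powr \<mu>"
    using q of_real_powr_complex[of "q\<^sup>2" \<mu>] by (simp add: of_real_powr_complex ln_realpow exp_add[symmetric] algebra_simps)
  have "bessel_K_quot \<mu> (of_real z) * (2 * (sin (of_real pi * \<mu>) / of_real pi)) =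
     (of_real q powr (- \<mu>) * bessel_clifford (- \<mu>) (of_real (q\<^sup>2)) - of_real q powr \<mu> * bessel_clifford \<mu> (of_real (q\<^sup>2)))"
    using s by (simp add: bessel_K_quot_def bessel_I_conv_bessel_clifford q_def mult.commute)
  also have "\<dots> = of_real q powr (- \<mu>) * (bessel_clifford (- \<mu>) (of_real (q\<^sup>2)) - of_real (q\<^sup>2) powr \<mu> * bessel_clifford \<mu> (of_real (q\<^sup>2)))"
    unfolding qq using q by (simp add: powr_minus field_simps)
  also have "bessel_clifford (- \<mu>) (of_real (q\<^sup>2)) - of_real (q\<^sup>2) powr \<mu> * bessel_clifford \<mu> (of_real (q\<^sup>2))
      = ext_Gamma \<mu> (q\<^sup>2) * (sin (of_real pi * \<mu>) / of_real pi)"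
    using q by (intro ext_Gamma_conv_bessel_clifford[symmetric]) auto
  finally show ?thesis using s by (simp add: q_def[symmetric] field_simps)
qed

text \<open>The right-hand side is continuous in the order and agrees with the quotient at all
  non-integer orders, so at an integer it is the limit in the definition.\<close>

lemma bessel_K_conv_ext_Gamma:
  assumes z: "z > 0"
  shows "bessel_K \<mu> (of_real z) = of_real (z / 2) powr (- \<mu>) * ext_Gamma \<mu> ((z / 2)\<^sup>2) / 2"
proof (cases "\<mu> \<in> \<int>")
  case False
  thus ?thesis using bessel_K_quot_conv_ext_Gamma[OF z] by (simp add: bessel_K_def)
next
  case True
  define J where "J = (\<lambda>\<mu>. of_real (z / 2) powr (- \<mu>) * ext_Gamma \<mu> ((z / 2)\<^sup>2) / 2)"
  have "isCont J \<mu>"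
    unfolding J_def using z by (intro continuous_intros continuous_ext_Gamma) auto
  hence "(J \<longlongrightarrow> J \<mu>) (at \<mu>)" by (simp add: isCont_def)
  moreover have "\<forall>\<^sub>F m in at \<mu>. J m = bessel_K_quot m (of_real z)"
  proof -
    \<comment> \<open>Every set of integers is closed, so the integers other than \<mu> are avoided
      on a neighbourhood of \<mu>.\<close>
    have "\<forall>\<^sub>F m in at \<mu>. m \<in> - (\<int> - {\<mu>})"
      by (intro eventually_at_in_open' open_Compl closed_subset_Ints) auto
    hence "\<forall>\<^sub>F m in at \<mu>. m \<notin> \<int>"
      using eventually_neq_at_within[of \<mu> \<mu> UNIV] by eventually_elim auto
    thus ?thesis
      by eventually_elim (simp add: J_def bessel_K_quot_conv_ext_Gamma[OF z])
  qed
  ultimately have "((\<lambda>m. bessel_K_quot m (of_real z)) \<longlongrightarrow> J \<mu>) (at \<mu>)"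
    by (rule Lim_transform_eventually)
  hence "Lim (at \<mu>) (\<lambda>m. bessel_K_quot m (of_real z)) = J \<mu>"
    by (intro tendsto_Lim) auto
  thus ?thesis using True by (simp add: bessel_K_def J_def)
qed

section \<open>Mellin transforms\<close>

text \<open>The integrability of the swapped inner integral is recorded too, since it becomes the
  existence of the Mellin integrals.\<close>

lemma Fubini_lborel:
  fixes f :: "real \<Rightarrow> real \<Rightarrow> complex"
  assumes [measurable]: "case_prod f \<in> borel_measurable (borel \<Otimes>\<^sub>M borel)"
    and int1: "\<And>x. integrable lborel (f x)"
    and int2: "integrable lborel (\<lambda>x. \<integral>y. norm (f x y) \<partial>lborel)"
  shows "integrable lborel (\<lambda>y. \<integral>x. f x y \<partial>lborel)"
    and "(\<integral>y. \<integral>x. f x y \<partial>lborel \<partial>lborel) = (\<integral>x. \<integral>y. f x y \<partial>lborel \<partial>lborel)"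
proof -
  have "integrable (lborel \<Otimes>\<^sub>M lborel) (case_prod f)"
    using int1 int2 by (intro lborel_pair.Fubini_integrable) (auto simp: measurable_lborel1)
  thus "integrable lborel (\<lambda>y. \<integral>x. f x y \<partial>lborel)"
    and "(\<integral>y. \<integral>x. f x y \<partial>lborel \<partial>lborel) = (\<integral>x. \<integral>y. f x y \<partial>lborel \<partial>lborel)"
    by (rule lborel_pair.integrable_snd, rule lborel_pair.Fubini_integral)
qed

text \<open>Both iterated integrals of \<open>p\<^sub>a(u) p\<^sub>b(r - u)\<close> with \<open>p\<^sub>c(v) = v\<^bsup>c-1\<^esup> e\<^bsup>-v\<^esup>\<close> are computed:
  one is \<open>\<Gamma>(a) \<Gamma>(b)\<close>, the other the Beta integral times \<open>\<Gamma>(a + b)\<close>.\<close>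
lemma Beta_integral_lborel:
  assumes a: "Re a > 0" and b: "Re b > 0"
  shows "set_integrable lborel {0<..<1} (\<lambda>t. of_real t powr (a - 1) * of_real (1 - t) powr (b - 1))"
    and "(LBINT t:{0<..<1}. of_real t powr (a - 1) * of_real (1 - t) powr (b - 1)) = Beta a b"
proof -
  let ?B = "\<lambda>t. complex_of_real t powr (a - 1) * of_real (1 - t) powr (b - 1)"
  define B where "B = (LBINT t:{0<..<1}. ?B t)"
  show "set_integrable lborel {0<..<1} ?B"
  proof (rule set_integrable_bound)
    show "set_integrable lborel {0<..<1} (\<lambda>t. t powr (Re a - 1) * (1 - t) powr (Re b - 1))"
      using integrable_Beta[OF a b] by (rule set_integrable_subset) auto
    show "set_borel_measurable lborel {0<..<1} ?B"
      unfolding set_borel_measurable_def by measurable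
    have "norm (?B t) \<le> norm (t powr (Re a - 1) * (1 - t) powr (Re b - 1))" if "t \<in> {0<..<1}" for t
      using that norm_of_real_powr[of "1 - t" "b - 1"] by (simp add: norm_mult norm_of_real_powr)
    thus "AE t in lborel. t \<in> {0<..<1} \<longrightarrow> norm (?B t) \<le> norm (t powr (Re a - 1) * (1 - t) powr (Re b - 1))"
      by simp
  qed
  define p where "p = (\<lambda>c v. indicator {0<..} v *\<^sub>R (complex_of_real v powr (c - 1) * of_real (exp (- v))))"
  have p_int: "integrable lborel (p c)" "integral\<^sup>L lborel (p c) = Gamma c" if "Re c > 0" for c
    using Gamma_integral_lborel[OF that] by (simp_all add: p_def set_integrable_def set_lebesgue_integral_def)
  have [measurable]: "p c \<in> borel_measurable borel" for c unfolding p_def by measurable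
  have shift: "integrable lborel (\<lambda>r. g (r - u)) \<longleftrightarrow> integrable lborel g"
       "(\<integral>r. g (r - u) \<partial>lborel) = integral\<^sup>L lborel g"
    for g :: "real \<Rightarrow> 'b :: {banach, second_countable_topology}" and u
    using lborel_integrable_real_affine_iff[of 1 g "- u"] lborel_integral_real_affine[of 1 g "- u"] by simp_all
  have conv: "(\<integral>u. p a u * p b (r - u) \<partial>lborel) = B * p (a + b) r" for r
  proof (cases "r > 0")
    case False
    hence "p a u * p b (r - u) = 0" for u by (auto simp: p_def indicator_def)
    hence "(\<integral>u. p a u * p b (r - u) \<partial>lborel) = 0" by (simp only: Bochner_Integration.integral_zero)
    thus ?thesis using False by (simp add: p_def)
  next
    case r: True
    \<comment> \<open>The scaling u = r t carries the support 0 < u < r to the unit interval; its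
      Jacobian raises the exponent of r from a + b - 2 to a + b - 1.\<close>
    have "(\<integral>u. p a u * p b (r - u) \<partial>lborel) = r *\<^sub>R (\<integral>t. p a (r * t) * p b (r - r * t) \<partial>lborel)"
      using r by (subst lborel_integral_real_affine[of r _ 0]) auto
    also have "(\<lambda>t. p a (r * t) * p b (r - r * t)) =
       (\<lambda>t. (of_real r powr (a + b - 2) * of_real (exp (- r))) * indicator {0<..<1} t *\<^sub>R ?B t)"
    proof
      fix t :: real
      show "p a (r * t) * p b (r - r * t) = (of_real r powr (a + b - 2) * of_real (exp (- r))) * indicator {0<..<1} t *\<^sub>R ?B t"
      proof (cases "t \<in> {0<..<1}")
        case t: True
        have pos: "r * t > 0" "r - r * t > 0" using r t by (auto simp: algebra_simps)
        have pa: "p a (r * t) = of_real r powr (a - 1) * of_real t powr (a - 1) * of_real (exp (- (r * t)))"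
          using pos r t by (simp add: p_def powr_times_real)
        have pb: "p b (r - r * t) = of_real r powr (b - 1) * of_real (1 - t) powr (b - 1) * of_real (exp (- (r - r * t)))"
          using pos r t powr_times_real[of "complex_of_real r" "complex_of_real (1 - t)" "b - 1"]
          by (simp add: p_def algebra_simps)
        have r_powr: "complex_of_real r powr (a + b - 2) = of_real r powr (a - 1) * of_real r powr (b - 1)"
          by (simp add: powr_add[symmetric])
        have "exp (- r) = exp (- (r * t)) * exp (- (r - r * t))"
          by (simp add: exp_add[symmetric])
        hence r_exp: "complex_of_real (exp (- r)) = of_real (exp (- (r * t))) * of_real (exp (- (r - r * t)))"
          by (simp only: of_real_mult)
        show ?thesis using t unfolding pa pb r_powr r_exp by (simp add: mult_ac)
      next
        case False
        hence "\<not> (r * t > 0 \<and> r - r * t > 0)" using r by (auto simp: zero_less_mult_iff)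
        thus ?thesis using False by (auto simp: p_def)
      qed
    qed
    also have "r *\<^sub>R (\<integral>t. (of_real r powr (a + b - 2) * of_real (exp (- r))) * indicator {0<..<1} t *\<^sub>R ?B t \<partial>lborel)
        = of_real r * (of_real r powr (a + b - 2) * of_real (exp (- r))) * B"
      by (simp only: B_def set_lebesgue_integral_def integral_mult_right_zero scaleR_conv_of_real mult.assoc)
    also have "\<dots> = B * p (a + b) r"
      using r powr_add[of "complex_of_real r" 1 "a + b - 2"] by (simp add: p_def)
    finally show ?thesis .
  qed
  \<comment> \<open>On the right, translation invariance of the inner integral separates the two
    factors.\<close>
  have "(\<integral>r. \<integral>u. p a u * p b (r - u) \<partial>lborel \<partial>lborel) = (\<integral>u. \<integral>r. p a u * p b (r - u) \<partial>lborel \<partial>lborel)"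
  proof (rule Fubini_lborel(2))
    show "integrable lborel (\<lambda>r. p a u * p b (r - u))" for u
      using p_int(1)[OF b] by (intro integrable_mult_right) (simp add: shift)
    have "(\<integral>r. norm (p a u * p b (r - u)) \<partial>lborel) = norm (p a u) * (\<integral>v. norm (p b v) \<partial>lborel)" for u
      using shift(2)[of "\<lambda>v. norm (p b v)" u] by (simp add: norm_mult)
    thus "integrable lborel (\<lambda>u. \<integral>r. norm (p a u * p b (r - u)) \<partial>lborel)"
      using p_int(1)[OF a] by simp
  qed measurable
  also have "\<dots> = Gamma a * Gamma b"
    using p_int(2) a b by (simp add: shift)
  also have "(\<integral>r. \<integral>u. p a u * p b (r - u) \<partial>lborel \<partial>lborel) = B * Gamma (a + b)"
    unfolding conv using p_int(2)[of "a + b"] a b by simp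
  finally have "B * Gamma (a + b) = Gamma a * Gamma b" .
  moreover have "a + b \<notin> \<int>\<^sub>\<le>\<^sub>0" using a b by (auto simp: complex_eq_iff elim!: nonpos_Ints_cases)
  hence "Gamma a * Gamma b = Beta a b * Gamma (a + b)" "Gamma (a + b) \<noteq> 0"
    by (simp_all add: Gamma_Gamma_Beta Gamma_eq_zero_iff)
  ultimately show "(LBINT t:{0<..<1}. ?B t) = Beta a b"
    by (simp add: B_def)
qed

text \<open>The substitution z = 2 sqrt (t v), with derivative sqrt (t / v), gives Euler's integral
  at \<alpha> / 2.\<close>

lemma mellin_gaussian:
  fixes \<alpha> :: complex
  assumes t: "t > 0" and \<alpha>: "Re \<alpha> > 0"
  shows "set_integrable lborel {0<..} (\<lambda>z. of_real (z / 2) powr (\<alpha> - 1) * of_real (exp (- (z / 2)\<^sup>2 / t)))"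
    and "(LBINT z:{0<..}. of_real (z / 2) powr (\<alpha> - 1) * of_real (exp (- (z / 2)\<^sup>2 / t))) =
         of_real t powr (\<alpha> / 2) * Gamma (\<alpha> / 2)"
proof -
  let ?f = "\<lambda>z. complex_of_real (z / 2) powr (\<alpha> - 1) * of_real (exp (- (z / 2)\<^sup>2 / t))"
  define g where "g = (\<lambda>v. 2 * sqrt (t * v))"
  define h where "h = (\<lambda>v. sqrt (t / v))"
  have im: "g ` {0<..} = {0<..}"
  proof -
    have "z \<in> g ` {0<..}" if "z > 0" for z
      using that t by (intro image_eqI[of _ _ "z\<^sup>2 / (4 * t)"]) (auto simp: g_def real_sqrt_divide)
    thus ?thesis using t by (auto simp: g_def)
  qed
  have der: "(g has_field_derivative h v) (at v)" if "v \<in> {0<..}" for v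
    using that t unfolding g_def h_def
    by (auto intro!: derivative_eq_intros simp: real_sqrt_mult real_sqrt_divide field_simps)
  have inj: "inj_on g {0<..}" using t by (auto simp: inj_on_def g_def)
  have [measurable]: "g \<in> borel_measurable borel" "h \<in> borel_measurable borel"
    unfolding g_def h_def by measurable
  have meas: "?f \<in> borel_measurable borel" "{0::real<..} \<in> sets borel" "g ` {0<..} \<in> sets borel"
    unfolding im by measurable
  note sub = substitution_lborel[OF meas(1) _ _ meas(2,3) der inj, simplified im]
  have eq: "\<bar>h v\<bar> *\<^sub>R ?f (g v) = of_real t powr (\<alpha> / 2) * (of_real v powr (\<alpha> / 2 - 1) * of_real (exp (- v)))"
    if "v > 0" for v
  proof -
    have g_eq: "complex_of_real (sqrt (t * v)) powr (\<alpha> - 1) = exp ((\<alpha> - 1) * (of_real (ln t) + of_real (ln v)) / 2)"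
      using t that of_real_powr_complex[of "sqrt (t * v)" "\<alpha> - 1"] by (simp add: ln_sqrt ln_mult)
    have h_eq: "complex_of_real (h v) = exp ((of_real (ln t) - of_real (ln v)) / 2)"
    proof -
      have "h v = exp ((ln t - ln v) / 2)"
      proof -
        have "h v = exp (ln (sqrt (t / v)))" using t that by (simp add: h_def)
        also have "ln (sqrt (t / v)) = (ln t - ln v) / 2" using t that by (simp add: ln_sqrt ln_div)
        finally show ?thesis .
      qed
      thus ?thesis by (simp add: exp_of_real[symmetric])
    qed
    have "of_real (h v) * complex_of_real (sqrt (t * v)) powr (\<alpha> - 1) =
        exp ((\<alpha> / 2) * of_real (ln t)) * exp ((\<alpha> / 2 - 1) * of_real (ln v))"
    proof -
      have "(of_real (ln t) - of_real (ln v)) / 2 + (\<alpha> - 1) * (of_real (ln t) + of_real (ln v)) / 2 =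
          (\<alpha> / 2) * of_real (ln t) + (\<alpha> / 2 - 1) * complex_of_real (ln v)"
        by (simp add: field_simps)
      with h_eq g_eq show ?thesis by (simp only: exp_add[symmetric])
    qed
    also have "\<dots> = of_real t powr (\<alpha> / 2) * of_real v powr (\<alpha> / 2 - 1)"
      using t that by (simp add: of_real_powr_complex)
    finally show ?thesis using t that
      by (simp add: g_def h_def scaleR_conv_of_real mult.assoc[symmetric])
  qed
  have cong: "set_integrable lborel {0<..} (\<lambda>v. \<bar>h v\<bar> *\<^sub>R ?f (g v)) \<longleftrightarrow>
      set_integrable lborel {0<..} (\<lambda>v. of_real t powr (\<alpha> / 2) * (of_real v powr (\<alpha> / 2 - 1) * of_real (exp (- v))))"
    using eq by (intro set_integrable_cong) auto
  have cong': "(LBINT v:{0<..}. \<bar>h v\<bar> *\<^sub>R ?f (g v)) =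
      (LBINT v:{0<..}. of_real t powr (\<alpha> / 2) * (of_real v powr (\<alpha> / 2 - 1) * of_real (exp (- v))))"
    using eq by (intro set_lebesgue_integral_cong) auto
  show "set_integrable lborel {0<..} ?f"
    using \<alpha> by (subst sub(1), measurable, subst cong) (auto intro!: set_integrable_mult_right Gamma_integral_lborel)
  show "(LBINT z:{0<..}. ?f z) = of_real t powr (\<alpha> / 2) * Gamma (\<alpha> / 2)"
    using \<alpha> Gamma_integral_lborel(2)[of "\<alpha> / 2"]
    by (subst sub(2), measurable, subst cong') simp
qed

text \<open>Insert the integral representation of K and integrate over z first. The Gaussian
  transform at c - \<mu> yields a power of t that turns the remaining integral into Euler's at (c +
  \<mu>) / 2; the hypotheses make both converge.\<close>

lemma mellin_bessel_K:
  assumes c: "Re (c - \<mu>) > 0" "Re (c + \<mu>) > 0"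
  shows "set_integrable lborel {0<..} (\<lambda>z. of_real z powr (c - 1) * bessel_K \<mu> (of_real z))"
    and "(LBINT z:{0<..}. of_real z powr (c - 1) * bessel_K \<mu> (of_real z)) =
         2 powr (c - 2) * Gamma ((c - \<mu>) / 2) * Gamma ((c + \<mu>) / 2)"
proof -
  let ?p = "\<lambda>c v. indicator {0<..} v *\<^sub>R (complex_of_real v powr (c - 1) * of_real (exp (- v)))"
  let ?g = "\<lambda>\<alpha> t z. indicator {0<..} z *\<^sub>R (complex_of_real (z / 2) powr (\<alpha> - 1) * of_real (exp (- (z / 2)\<^sup>2 / t)))"
  \<comment> \<open>The constant comes from z powr (c - 1) * (z / 2) powr (- \<mu>) / 2 = 2 powr (c
    - 2) * (z / 2) powr (c - \<mu> - 1).\<close>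
  define f where "f = (\<lambda>t z. 2 powr (c - 2) * ?p \<mu> t * ?g (c - \<mu>) t z)"
  have g_int: "integrable lborel (?g \<alpha> t)" "integral\<^sup>L lborel (?g \<alpha> t) = of_real t powr (\<alpha> / 2) * Gamma (\<alpha> / 2)"
    if "t > 0" "Re \<alpha> > 0" for t \<alpha>
    using mellin_gaussian[OF that] by (simp_all add: set_integrable_def set_lebesgue_integral_def)
  have p_int: "integrable lborel (?p c)" "integral\<^sup>L lborel (?p c) = Gamma c" if "Re c > 0" for c
    using Gamma_integral_lborel[OF that] by (simp_all add: set_integrable_def set_lebesgue_integral_def)
  have p_mult: "?p \<mu> t * of_real t powr ((c - \<mu>) / 2) = ?p ((c + \<mu>) / 2) t" for t
  proof (cases "t > 0")
    case True
    have "complex_of_real t powr (\<mu> - 1) * of_real t powr ((c - \<mu>) / 2) = of_real t powr ((c + \<mu>) / 2 - 1)"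
      by (simp add: powr_add[symmetric] field_simps)
    thus ?thesis using True by (simp add: mult_ac)
  qed auto
  have f_int: "integrable lborel (f t)" for t
  proof (cases "t > 0")
    case True
    show ?thesis unfolding f_def by (intro integrable_mult_right g_int(1) True c)
  qed (simp add: f_def)
  have f_eq: "(\<integral>z. f t z \<partial>lborel) = 2 powr (c - 2) * Gamma ((c - \<mu>) / 2) * ?p ((c + \<mu>) / 2) t" for t
  proof (cases "t > 0")
    case True
    have "(\<integral>z. f t z \<partial>lborel) = 2 powr (c - 2) * ?p \<mu> t * (of_real t powr ((c - \<mu>) / 2) * Gamma ((c - \<mu>) / 2))"
      unfolding f_def integral_mult_right_zero using g_int(2)[OF True c(1)] by simp
    thus ?thesis using p_mult[of t] by (simp only: mult_ac)
  qed (simp add: f_def)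
  have f_norm: "(\<integral>z. norm (f t z) \<partial>lborel) =
      norm (2 powr (c - 2)) * norm (Gamma (of_real (Re (c - \<mu>)) / 2 :: complex)) * norm (?p ((c + \<mu>) / 2) t)" for t
  proof (cases "t > 0")
    case True
    \<comment> \<open>Norms replace the exponent c - \<mu> by its real part, so the norm integral is
      again a Gaussian transform.\<close>
    define \<alpha> where "\<alpha> = complex_of_real (Re (c - \<mu>))"
    have "complex_of_real (norm (?g (c - \<mu>) t z)) = ?g \<alpha> t z" for z
    proof (cases "z > 0")
      case z: True
      thus ?thesis using norm_of_real_powr[of "z / 2" "c - \<mu> - 1"] powr_of_real[of "z / 2" "Re (c - \<mu>) - 1"]
        by (simp add: norm_mult \<alpha>_def)
    qed auto
    hence int_eq: "complex_of_real (\<integral>z. norm (?g (c - \<mu>) t z) \<partial>lborel) = of_real t powr (\<alpha> / 2) * Gamma (\<alpha> / 2)"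
      unfolding integral_complex_of_real[symmetric] using g_int(2)[of t \<alpha>] True c by (simp add: \<alpha>_def)
    hence "norm (of_real t powr (\<alpha> / 2) * Gamma (\<alpha> / 2)) = \<bar>\<integral>z. norm (?g (c - \<mu>) t z) \<partial>lborel\<bar>"
      by (simp only: norm_of_real flip: int_eq)
    hence "(\<integral>z. norm (?g (c - \<mu>) t z) \<partial>lborel) = norm (of_real t powr (\<alpha> / 2) * Gamma (\<alpha> / 2))"
      by (simp only: abs_of_nonneg[OF Bochner_Integration.integral_nonneg[OF norm_ge_zero]])
    also have "\<dots> = norm (of_real t powr ((c - \<mu>) / 2)) * norm (Gamma (\<alpha> / 2))"
      using True by (simp add: norm_mult norm_of_real_powr \<alpha>_def)
    finally have "(\<integral>z. norm (f t z) \<partial>lborel) = norm (2 powr (c - 2)) * norm (Gamma (\<alpha> / 2)) *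
        norm (?p \<mu> t * of_real t powr ((c - \<mu>) / 2))"
      unfolding f_def norm_mult integral_mult_right_zero by (simp only: mult_ac)
    thus ?thesis unfolding p_mult \<alpha>_def .
  qed (simp add: f_def)
  have p1: "integrable lborel (?p ((c + \<mu>) / 2))" "integral\<^sup>L lborel (?p ((c + \<mu>) / 2)) = Gamma ((c + \<mu>) / 2)"
    using c by (intro p_int; simp)+
  have K_eq: "(\<integral>t. f t z \<partial>lborel) = indicator {0<..} z *\<^sub>R (of_real z powr (c - 1) * bessel_K \<mu> (of_real z))" for z
  proof (cases "z > 0")
    case z: True
    have "f t z = of_real z powr (c - 1) * of_real (z / 2) powr (- \<mu>) / 2 *
        (indicator {0<..} t *\<^sub>R (of_real t powr (\<mu> - 1) * of_real (exp (- t - (z / 2)\<^sup>2 / t))))" for t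
    proof -
      have "2 powr (c - 2) * complex_of_real (z / 2) powr (c - \<mu> - 1) =
         exp ((c - 2) * of_real (ln 2)) * exp ((c - \<mu> - 1) * (of_real (ln z) - of_real (ln 2)))"
        using z of_real_powr_complex[of "z / 2" "c - \<mu> - 1"] of_real_powr_complex[of 2 "c - 2"]
        by (simp add: ln_div)
      also have "\<dots> = exp ((c - 1) * of_real (ln z)) * exp (- \<mu> * (of_real (ln z) - of_real (ln 2))) / exp (of_real (ln 2))"
        by (simp add: exp_add[symmetric] exp_diff[symmetric] algebra_simps)
      also have "\<dots> = of_real z powr (c - 1) * of_real (z / 2) powr (- \<mu>) / 2"
        using z of_real_powr_complex[of "z / 2" "- \<mu>"] of_real_powr_complex[of z "c - 1"]
        by (simp add: ln_div exp_of_real)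
      finally have powr_eq: "2 powr (c - 2) * complex_of_real (z / 2) powr (c - \<mu> - 1) = \<dots>" .
      have exp_eq: "exp (- t - (z / 2)\<^sup>2 / t) = exp (- t) * exp (- (z / 2)\<^sup>2 / t)"
        by (simp add: exp_add[symmetric])
      show ?thesis using z unfolding f_def powr_eq[symmetric] exp_eq of_real_mult
        by (simp add: mult_ac)
    qed
    hence "(\<integral>t. f t z \<partial>lborel) = of_real z powr (c - 1) * of_real (z / 2) powr (- \<mu>) / 2 * ext_Gamma \<mu> ((z / 2)\<^sup>2)"
      by (simp only: ext_Gamma_def set_lebesgue_integral_def integral_mult_right_zero)
    thus ?thesis using z unfolding bessel_K_conv_ext_Gamma[OF z] by simp
  qed (simp add: f_def)
  have meas: "case_prod f \<in> borel_measurable (borel \<Otimes>\<^sub>M borel)"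
    unfolding f_def by measurable
  have int_norm: "integrable lborel (\<lambda>t. \<integral>z. norm (f t z) \<partial>lborel)"
    unfolding f_norm by (intro integrable_mult_right integrable_norm p1)
  note F = Fubini_lborel[OF meas f_int int_norm, unfolded K_eq]
  show "set_integrable lborel {0<..} (\<lambda>z. of_real z powr (c - 1) * bessel_K \<mu> (of_real z))"
    using F(1) by (simp add: set_integrable_def)
  show "(LBINT z:{0<..}. of_real z powr (c - 1) * bessel_K \<mu> (of_real z)) =
         2 powr (c - 2) * Gamma ((c - \<mu>) / 2) * Gamma ((c + \<mu>) / 2)"
    using F(2) p1(2) unfolding f_eq integral_mult_right_zero by (simp add: set_lebesgue_integral_def)
qed

section \<open>Separation of the double integral into a Bessel and a Beta factor\<close>

theorem theorem6:
  fixes x y \<nu> s :: complex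
  assumes "Re (x + s) > 0" and "Re (y + s) > 0"
    and "Re (s - \<nu>) > 0" and "Re (s + \<nu>) > -1"
  shows "set_integrable lborel {0<..} (\<lambda>p. of_real p powr (s - 1) * ext_Beta \<nu> x y p) \<and>
    (LBINT p:{0<..}. of_real p powr (s - 1) * ext_Beta \<nu> x y p) =
      2 powr (s - 1) / of_real (sqrt pi) * Gamma ((s - \<nu>) / 2) * Gamma ((s + \<nu> + 1) / 2) *
      Beta (x + s) (y + s)"
proof -
  \<comment> \<open>The exponent is s - 1/2 because the prefactor of \<open>ext_Beta\<close>
    contributes a further sqrt p to p powr (s - 1).\<close>
  define k where "k = (\<lambda>z. indicator {0<..} z *\<^sub>R (complex_of_real z powr (s - 1 / 2) * bessel_K (\<nu> + 1 / 2) (of_real z)))"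
  have k: "integrable lborel k" "integral\<^sup>L lborel k = 2 powr (s - 3 / 2) * Gamma ((s - \<nu>) / 2) * Gamma ((s + \<nu> + 1) / 2)"
  proof -
    have c: "Re (s + 1 / 2 - (\<nu> + 1 / 2)) > 0" "Re (s + 1 / 2 + (\<nu> + 1 / 2)) > 0" using assms by auto
    have e: "s + 1 / 2 - 1 = s - 1 / 2" "s + 1 / 2 - 2 = s - 3 / 2" "s + 1 / 2 - (\<nu> + 1 / 2) = s - \<nu>"
      "s + 1 / 2 + (\<nu> + 1 / 2) = s + \<nu> + 1" by auto
    show "integrable lborel k" "integral\<^sup>L lborel k = 2 powr (s - 3 / 2) * Gamma ((s - \<nu>) / 2) * Gamma ((s + \<nu> + 1) / 2)"
      using mellin_bessel_K[OF c] unfolding k_def e set_integrable_def set_lebesgue_integral_def by auto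
  qed
  have [measurable]: "k \<in> borel_measurable borel" using borel_measurable_integrable[OF k(1)] by simp
  define C where "C = complex_of_real (sqrt (2 / pi))"
  define b where "b = (\<lambda>t. indicator {0<..<1} t *\<^sub>R (complex_of_real t powr (x + s - 1) * of_real (1 - t) powr (y + s - 1)))"
  have b: "integrable lborel b" "integral\<^sup>L lborel b = Beta (x + s) (y + s)"
    using Beta_integral_lborel[OF assms(1,2)] by (simp_all add: b_def set_integrable_def set_lebesgue_integral_def)
  have [measurable]: "b \<in> borel_measurable borel" using borel_measurable_integrable[OF b(1)] by simp
  \<comment> \<open>The Mellin integrand in the variable z = p / (t (1 - t)). The power p powr (s -
    1/2) leaves (t (1 - t)) powr (s - 1/2) behind, giving exponents x + s - 2 and y + s - 2; one
    factor t (1 - t) is split off so that the scaling in p preserves the integral of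
    \<open>k\<close>.\<close>
  define f where "f = (\<lambda>t p. C * b t * (k (p / (t * (1 - t))) / of_real (t * (1 - t))))"
  \<comment> \<open>Outside the open unit interval this makes \<open>f\<close> zero, whatever the
    quotient by t (1 - t) evaluates to.\<close>
  have b0: "b t = 0" if "t \<notin> {0<..<1}" for t using that by (simp add: b_def)
  have scale: "integrable lborel (\<lambda>p. g (p / q) / of_real q)"
     "(\<integral>p. g (p / q) / of_real q \<partial>lborel) = integral\<^sup>L lborel g"
    if "integrable lborel g" "q > 0" for g :: "real \<Rightarrow> 'b :: {real_normed_field, banach, second_countable_topology}" and q
  proof -
    show "integrable lborel (\<lambda>p. g (p / q) / of_real q)"
      using lborel_integrable_real_affine[OF that(1), of "1 / q" 0] that(2) by simp
    show "(\<integral>p. g (p / q) / of_real q \<partial>lborel) = integral\<^sup>L lborel g"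
      using lborel_integral_real_affine[of "1 / q" g 0] that(2) by (simp add: scaleR_conv_of_real)
  qed
  have q: "t * (1 - t) > 0" if "t \<in> {0<..<1}" for t :: real using that by auto
  have f_int: "integrable lborel (f t)" for t
  proof (cases "t \<in> {0<..<1}")
    case True
    show ?thesis unfolding f_def by (intro integrable_mult_right scale(1) k q True)
  qed (simp add: f_def b0)
  have f_eq: "(\<integral>p. f t p \<partial>lborel) = C * integral\<^sup>L lborel k * b t" for t
  proof (cases "t \<in> {0<..<1}")
    case True
    show ?thesis unfolding f_def integral_mult_right_zero scale(2)[OF k(1) q[OF True]] by simp
  qed (simp add: f_def b0)
  have f_norm: "(\<integral>p. norm (f t p) \<partial>lborel) = norm C * (\<integral>z. norm (k z) \<partial>lborel) * norm (b t)" for t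
  proof (cases "t \<in> {0<..<1}")
    case True
    have "norm (f t p) = norm (C * b t) * (norm (k (p / (t * (1 - t)))) / of_real (t * (1 - t)))" for p
      using q[OF True] unfolding f_def norm_mult norm_divide norm_of_real by simp
    hence "(\<integral>p. norm (f t p) \<partial>lborel) = norm (C * b t) * (\<integral>z. norm (k z) \<partial>lborel)"
      using scale(2)[OF integrable_norm[OF k(1)] q[OF True]] by (simp only: integral_mult_right_zero)
    thus ?thesis by (simp add: norm_mult)
  qed (simp add: f_def b0)
  have int_norm: "integrable lborel (\<lambda>t. \<integral>p. norm (f t p) \<partial>lborel)"
    unfolding f_norm by (intro integrable_mult_right integrable_norm b)
  have meas: "case_prod f \<in> borel_measurable (borel \<Otimes>\<^sub>M borel)"
    unfolding f_def by measurable
  have eB: "(\<integral>t. f t p \<partial>lborel) = indicator {0<..} p *\<^sub>R (of_real p powr (s - 1) * ext_Beta \<nu> x y p)" for p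
  proof (cases "p > 0")
    case p: True
    have "f t p = of_real p powr (s - 1) * of_real (sqrt (2 * p / pi)) *
       (indicator {0<..<1} t *\<^sub>R (of_real t powr (x - 3 / 2) * of_real (1 - t) powr (y - 3 / 2) *
        bessel_K (\<nu> + 1 / 2) (of_real (p / (t * (1 - t))))))" for t
    proof (cases "t \<in> {0<..<1}")
      case t: True
      \<comment> \<open>With all powers written as exponentials of real logarithms, the claim
        becomes a linear identity between exponents.\<close>
      define P T U where "P = complex_of_real (ln p)" and "T = complex_of_real (ln t)" and "U = complex_of_real (ln (1 - t))"
      have k_eq: "k (p / (t * (1 - t))) = of_real (p / (t * (1 - t))) powr (s - 1 / 2) * bessel_K (\<nu> + 1 / 2) (of_real (p / (t * (1 - t))))"
        using p q[OF t] by (simp add: k_def del: of_real_divide of_real_mult)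
      have pq_eq: "complex_of_real (p / (t * (1 - t))) powr (s - 1 / 2) = exp ((s - 1 / 2) * (P - T - U))"
      proof -
        have "ln (p / (t * (1 - t))) = ln p - ln t - ln (1 - t)"
          using p t by (simp add: ln_div ln_mult)
        thus ?thesis using p q[OF t]
          by (simp add: of_real_powr_complex P_def T_def U_def del: of_real_divide of_real_mult)
      qed
      have b_eq: "b t = exp ((x + s - 1) * T) * exp ((y + s - 1) * U)"
        using t by (simp add: b_def of_real_powr_complex T_def U_def del: of_real_diff)
      have q_eq: "1 / complex_of_real (t * (1 - t)) = exp (- T) * exp (- U)"
      proof -
        have "complex_of_real t = exp T" "complex_of_real (1 - t) = exp U"
          using t by (simp_all add: T_def U_def exp_of_real del: of_real_diff)
        thus ?thesis by (simp only: of_real_mult) (simp add: exp_minus divide_inverse)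
      qed
      have C_eq: "C * exp (P / 2) = complex_of_real (sqrt (2 * p / pi))"
      proof -
        have "sqrt (2 * p / pi) = sqrt (2 / pi) * sqrt p" by (simp add: real_sqrt_mult[symmetric])
        also have "sqrt p = exp (ln p / 2)" using p by (simp add: ln_sqrt[symmetric])
        finally show ?thesis by (simp add: C_def P_def exp_of_real[symmetric])
      qed
      have powr_eq: "complex_of_real p powr (s - 1) = exp ((s - 1) * P)"
        "complex_of_real t powr (x - 3 / 2) = exp ((x - 3 / 2) * T)"
        "complex_of_real (1 - t) powr (y - 3 / 2) = exp ((y - 3 / 2) * U)"
        using p t by (simp_all add: of_real_powr_complex P_def T_def U_def del: of_real_diff)
      have exp_eq: "exp ((x + s - 1) * T) * exp ((y + s - 1) * U) * (exp (- T) * exp (- U)) * exp ((s - 1 / 2) * (P - T - U))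
          = exp ((s - 1) * P) * exp (P / 2) * exp ((x - 3 / 2) * T) * exp ((y - 3 / 2) * U)"
      proof -
        have "(x + s - 1) * T + (y + s - 1) * U + (- T + - U) + (s - 1 / 2) * (P - T - U) =
            (s - 1) * P + P / 2 + (x - 3 / 2) * T + (y - 3 / 2) * U"
          by (simp add: field_simps)
        thus ?thesis by (simp only: exp_add[symmetric])
      qed
      let ?K = "bessel_K (\<nu> + 1 / 2) (of_real (p / (t * (1 - t))))"
      have "f t p = C * (b t * (1 / of_real (t * (1 - t))) * of_real (p / (t * (1 - t))) powr (s - 1 / 2)) * ?K"
        unfolding f_def k_eq by simp
      also have "\<dots> = exp ((s - 1) * P) * (C * exp (P / 2)) * (exp ((x - 3 / 2) * T) * exp ((y - 3 / 2) * U) * ?K)"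
        unfolding b_eq q_eq pq_eq exp_eq by (simp only: mult_ac)
      finally show ?thesis using t unfolding powr_eq C_eq by simp
    qed (simp add: f_def b0)
    hence "(\<integral>t. f t p \<partial>lborel) = of_real p powr (s - 1) * ext_Beta \<nu> x y p"
      by (simp only: ext_Beta_def set_lebesgue_integral_def integral_mult_right_zero mult.assoc)
    thus ?thesis using p by simp
  next
    case False
    have "f t p = 0" for t
    proof (cases "t \<in> {0<..<1}")
      case True
      have "\<not> p / (t * (1 - t)) > 0" using False q[OF True] by (simp add: zero_less_divide_iff)
      thus ?thesis by (simp add: f_def k_def)
    qed (simp add: f_def b0)
    thus ?thesis using False by simp
  qed
  note F = Fubini_lborel[OF meas f_int int_norm, unfolded eB]
  have "(LBINT p:{0<..}. of_real p powr (s - 1) * ext_Beta \<nu> x y p) = C * integral\<^sup>L lborel k * Beta (x + s) (y + s)"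
    using F(2) b(2) unfolding f_eq integral_mult_right_zero by (simp add: set_lebesgue_integral_def)
  also have "C * integral\<^sup>L lborel k =
     2 powr (s - 1) / of_real (sqrt pi) * Gamma ((s - \<nu>) / 2) * Gamma ((s + \<nu> + 1) / 2)"
  proof -
    \<comment> \<open>The factor sqrt 2 of \<open>C\<close> accounts for the missing half in the
      exponent of 2.\<close>
    have "2 powr (s - 3 / 2) * complex_of_real (sqrt 2) = 2 powr (s - 1)"
    proof -
      have "complex_of_real (sqrt 2) = 2 powr (1 / 2)"
        using powr_of_real[of 2 "1 / 2"] by (simp add: powr_half_sqrt)
      thus ?thesis by (simp add: powr_add[symmetric])
    qed
    hence "C * 2 powr (s - 3 / 2) = 2 powr (s - 1) / of_real (sqrt pi)"
      by (simp add: C_def real_sqrt_divide field_simps)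
    thus ?thesis unfolding k(2) by (simp only: mult.assoc[symmetric])
  qed
  finally show ?thesis using F(1) by (simp add: set_integrable_def)
qed

end
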